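(* Let $T$ be an $n$-simplex and let $0\le k\le n$. The space $\mathbb{C}\mathcal{P}_{0}\Lambda^{k}(T)$ of constant complex differential $k$-forms over $T$ has a $\mathbb{C}$-invariant basis only if $k=0$, or $k=n$, or $n=\dim T\le3$, or $k=2$ and $n=\dim T=4$.
   Context: $T$ is the convex hull of affinely independent points $v_0,\dots,v_n$ in a Euclidean space; $\lambda_i$ are its barycentric coordinates (affine functions on $T$ with $\lambda_i(v_j)=\delta_{ij}$), $d\lambda_i$ their exterior derivatives. $\mathbb{C}\mathcal{P}_0\Lambda^k(T)$ is the $\mathbb{C}$-span of the forms $d\lambda_{i_1}\wedge\dots\wedge d\lambda_{i_k}$ (constants if $k=0$), i.e. the constant complex $k$-forms on $T$. $\mathrm{Perm}(n)$ is the group of permutations of $\{0,\dots,n\}$; for $\pi\in\mathrm{Perm}(n)$, $S_\pi:T\to T$ is the affine automorphism with $S_\pi(v_i)=v_{\pi^{-1}(i)}$, with pullback $S_\pi^*$ on forms. A finite set $\{\omega_1,\dots,\omega_M\}$ of pairwise distinct complex forms on $T$ is $\mathbb{C}$-invariant if for every $\pi\in\mathrm{Perm}(n)$ there are a permutation $\tau$ of $\{1,\dots,M\}$ and $\chi_1,\dots,\chi_M\in\mathbb{C}$ with $|\chi_i|=1$ and $S_\pi^*\omega_i=\chi_i\omega_{\tau(i)}$ for all $i$. *)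

theory Defs
  imports "HOL-Analysis.Analysis" "HOL-Library.Function_Algebras"
begin

text \<open>
  The simplex with vertices \<open>v 0, \<dots>, v n\<close> may be lower-dimensional than the ambient Euclidean
  space, so tangent vectors are restricted to the direction space of the simplex.
\<close>

definition simplex_vertices :: "nat \<Rightarrow> (nat \<Rightarrow> 'a::euclidean_space) \<Rightarrow> bool" where
  "simplex_vertices n v \<longleftrightarrow> inj_on v {0..n} \<and> \<not> affine_dependent (v ` {0..n})"

definition simplex_hull :: "nat \<Rightarrow> (nat \<Rightarrow> 'a::euclidean_space) \<Rightarrow> 'a set" where
  "simplex_hull n v = convex hull (v ` {0..n})"

definition tangent :: "'a::euclidean_space set \<Rightarrow> 'a set" where
  "tangent T = span {x - y | x y. x \<in> T \<and> y \<in> T}"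

definition affine_on :: "'a::real_vector set \<Rightarrow> ('a \<Rightarrow> 'b::real_vector) \<Rightarrow> bool" where
  "affine_on T f \<longleftrightarrow>
    (\<forall>x\<in>T. \<forall>y\<in>T. \<forall>u\<in>{0..1}. f ((1 - u) *\<^sub>R x + u *\<^sub>R y) = (1 - u) *\<^sub>R f x + u *\<^sub>R f y)"

text \<open>
  The affine function on the simplex with value \<open>w j\<close> at \<open>v j\<close>, set to \<open>0\<close> off the simplex;
  existence and uniqueness is \<open>ex1_affine_extension\<close> below.
\<close>

definition affine_extension ::
    "nat \<Rightarrow> (nat \<Rightarrow> 'a::euclidean_space) \<Rightarrow> (nat \<Rightarrow> 'b::real_vector) \<Rightarrow> 'a \<Rightarrow> 'b" where
  "affine_extension n v w = (THE f. affine_on (simplex_hull n v) f \<and> (\<forall>j\<in>{0..n}. f (v j) = w j)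
     \<and> (\<forall>x. x \<notin> simplex_hull n v \<longrightarrow> f x = 0))"

definition barycentric :: "nat \<Rightarrow> (nat \<Rightarrow> 'a::euclidean_space) \<Rightarrow> nat \<Rightarrow> 'a \<Rightarrow> real" where
  "barycentric n v i = affine_extension n v (\<lambda>j. if i = j then 1 else 0)"

definition simplex_aut :: "nat \<Rightarrow> (nat \<Rightarrow> 'a::euclidean_space) \<Rightarrow> (nat \<Rightarrow> nat) \<Rightarrow> 'a \<Rightarrow> 'a" where
  "simplex_aut n v \<pi> = affine_extension n v (\<lambda>j. v (inv \<pi> j))"

lemma simplex_vertices_coeffs_unique:
  assumes "simplex_vertices n v"
    and "sum c {0..n} = sum d {0..n}"
    and "(\<Sum>i\<in>{0..n}. c i *\<^sub>R v i) = (\<Sum>i\<in>{0..n}. d i *\<^sub>R v i)"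
    and "i \<in> {0..n}"
  shows "c i = d i"
proof (rule ccontr)
  assume ne: "c i \<noteq> d i"
  have inj: "inj_on v {0..n}" and ind: "\<not> affine_dependent (v ` {0..n})"
    using assms(1) by (auto simp: simplex_vertices_def)
  define U where "U x = (let j = inv_into {0..n} v x in c j - d j)" for x
  have U: "U (v j) = c j - d j" if "j \<in> {0..n}" for j
    using that inj by (simp add: U_def inv_into_f_f)
  have "sum U (v ` {0..n}) = 0"
    using assms(2) U by (simp add: sum.reindex[OF inj] sum_subtractf)
  moreover have "(\<Sum>x\<in>v ` {0..n}. U x *\<^sub>R x) = 0"
    using assms(3) U by (simp add: sum.reindex[OF inj] sum_subtractf scaleR_left_diff_distrib)
  moreover have "U (v i) \<noteq> 0"
    using U assms(4) ne by simp
  ultimately have "affine_dependent (v ` {0..n})"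
    using assms(4) affine_dependent_explicit_finite[of "v ` {0..n}"] by blast
  with ind show False by simp
qed

lemma affine_on_simplex_unique:
  assumes "affine_on (simplex_hull n v) f" "affine_on (simplex_hull n v) g"
    and "\<And>j. j \<in> {0..n} \<Longrightarrow> f (v j) = g (v j)"
    and "x \<in> simplex_hull n v"
  shows "f x = g x"
proof -
  let ?E = "{x \<in> simplex_hull n v. f x = g x}"
  have T: "convex (simplex_hull n v)" by (simp add: simplex_hull_def)
  have "convex ?E"
    unfolding convex_alt using assms(1,2) T by (auto simp: affine_on_def convex_alt)
  moreover have "v ` {0..n} \<subseteq> ?E"
    using assms(3) by (auto simp: simplex_hull_def hull_inc)
  ultimately have "simplex_hull n v \<subseteq> ?E"
    unfolding simplex_hull_def[of n v, symmetric] by (metis hull_minimal simplex_hull_def)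
  with assms(4) show ?thesis by blast
qed

lemma ex1_affine_extension:
  fixes v :: "nat \<Rightarrow> 'a::euclidean_space" and w :: "nat \<Rightarrow> 'b::real_vector"
  assumes "simplex_vertices n v"
  shows "\<exists>!f. affine_on (simplex_hull n v) f \<and> (\<forall>j\<in>{0..n}. f (v j) = w j)
     \<and> (\<forall>x. x \<notin> simplex_hull n v \<longrightarrow> f x = 0)"
proof -
  have inj: "inj_on v {0..n}" using assms by (simp add: simplex_vertices_def)
  let ?T = "simplex_hull n v"
  let ?P = "\<lambda>x c. sum c {0..n} = 1 \<and> (\<Sum>i\<in>{0..n}. c i *\<^sub>R v i) = x"
  define c where "c x = (SOME c. ?P x c)" for x :: 'a
  have c: "?P x (c x)" if "x \<in> ?T" for x
  proof -
    obtain u where "sum u (v ` {0..n}) = 1" "(\<Sum>y\<in>v ` {0..n}. u y *\<^sub>R y) = x"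
      using \<open>x \<in> ?T\<close> by (auto simp: simplex_hull_def convex_hull_finite)
    then have "?P x (u \<circ> v)" by (simp add: sum.reindex[OF inj])
    then show ?thesis unfolding c_def by (rule someI[of "?P x"])
  qed
  have c_eq: "c x i = d i" if "x \<in> ?T" "?P x d" "i \<in> {0..n}" for x d i
    using simplex_vertices_coeffs_unique[OF assms, of "c x" d i] c[OF that(1)] that by simp
  define f where "f x = (if x \<in> ?T then \<Sum>i\<in>{0..n}. c x i *\<^sub>R w i else 0)" for x
  have "affine_on ?T f"
    unfolding affine_on_def
  proof (intro ballI)
    fix x y and u :: real
    assume x: "x \<in> ?T" and y: "y \<in> ?T" and u: "u \<in> {0..1}"
    let ?z = "(1 - u) *\<^sub>R x + u *\<^sub>R y" and ?d = "\<lambda>i. (1 - u) * c x i + u * c y i"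
    have z: "?z \<in> ?T"
      using x y u convex_convex_hull[of "v ` {0..n}"] by (auto simp: simplex_hull_def convex_alt)
    have "sum ?d {0..n} = 1"
      using c[OF x] c[OF y] by (simp add: sum.distrib sum_distrib_left[symmetric])
    moreover have "(\<Sum>i\<in>{0..n}. ?d i *\<^sub>R v i)
        = (1 - u) *\<^sub>R (\<Sum>i\<in>{0..n}. c x i *\<^sub>R v i) + u *\<^sub>R (\<Sum>i\<in>{0..n}. c y i *\<^sub>R v i)"
      by (simp add: scaleR_left_distrib sum.distrib scaleR_right.sum)
    then have "(\<Sum>i\<in>{0..n}. ?d i *\<^sub>R v i) = ?z"
      using c[OF x] c[OF y] by simp
    ultimately have "c ?z i = ?d i" if "i \<in> {0..n}" for i
      using c_eq[OF z _ that] by blast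
    then have "f ?z = (\<Sum>i\<in>{0..n}. ?d i *\<^sub>R w i)"
      using z by (simp add: f_def)
    then show "f ?z = (1 - u) *\<^sub>R f x + u *\<^sub>R f y"
      using x y by (simp add: f_def scaleR_left_distrib sum.distrib scaleR_right.sum)
  qed
  moreover have "f (v j) = w j" if j: "j \<in> {0..n}" for j
  proof -
    have T: "v j \<in> ?T" using j by (auto simp: simplex_hull_def hull_inc)
    have "?P (v j) (\<lambda>i. if i = j then 1 else 0)"
      using j by (simp add: if_distrib[of "\<lambda>a. a *\<^sub>R _"] sum.delta cong: if_cong)
    then have "c (v j) i = (if i = j then 1 else 0)" if "i \<in> {0..n}" for i
      using c_eq[OF T _ that] by blast
    then have "f (v j) = (\<Sum>i\<in>{0..n}. (if i = j then 1 else 0) *\<^sub>R w i)"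
      using T by (simp add: f_def)
    then show ?thesis
      using j by (simp add: if_distrib[of "\<lambda>a. a *\<^sub>R _"] sum.delta cong: if_cong)
  qed
  moreover have "f x = 0" if "x \<notin> ?T" for x
    using that by (simp add: f_def)
  ultimately have f: "affine_on ?T f \<and> (\<forall>j\<in>{0..n}. f (v j) = w j) \<and> (\<forall>x. x \<notin> ?T \<longrightarrow> f x = 0)"
    by blast
  show ?thesis
  proof (rule ex1I[of _ f])
    show "affine_on ?T f \<and> (\<forall>j\<in>{0..n}. f (v j) = w j) \<and> (\<forall>x. x \<notin> ?T \<longrightarrow> f x = 0)"
      by (rule f)
  next
    fix g
    assume g: "affine_on ?T g \<and> (\<forall>j\<in>{0..n}. g (v j) = w j) \<and> (\<forall>x. x \<notin> ?T \<longrightarrow> g x = 0)"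
    show "g = f"
    proof
      fix x
      show "g x = f x"
        using f g affine_on_simplex_unique[of n v g f x] by (cases "x \<in> ?T") auto
    qed
  qed
qed

text \<open>
  A complex \<open>k\<close>-form on \<open>T\<close> is a function of a point \<open>x \<in> T\<close> and a list of \<open>k\<close> tangent vectors;
  all operations below yield \<open>0\<close> outside of these arguments, so that equality of functions is
  equality of forms on \<open>T\<close>.
\<close>

type_synonym 'a cform = "'a \<Rightarrow> 'a list \<Rightarrow> complex"

definition form_scale :: "complex \<Rightarrow> 'a cform \<Rightarrow> 'a cform" where
  "form_scale c \<omega> = (\<lambda>x ws. c * \<omega> x ws)"

global_interpretation cform: vector_space form_scale
  by unfold_locales
     (auto simp: form_scale_def fun_eq_iff algebra_simps)

text \<open>
  The exterior derivative of a function on \<open>T\<close>. The derivative relative to \<open>T\<close> is unique only on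
  tangent vectors, the only ones at which it is evaluated below.
\<close>

definition ext_deriv ::
    "'a::euclidean_space set \<Rightarrow> ('a \<Rightarrow> real) \<Rightarrow> 'a \<Rightarrow> 'a \<Rightarrow> real" where
  "ext_deriv T f x = frechet_derivative f (at x within T)"

text \<open>
  The wedge product of real \<open>1\<close>-forms, as a complex form, with the normalisation
  \<open>(\<alpha>\<^sub>1 \<and> \<dots> \<and> \<alpha>\<^sub>k)(w\<^sub>1, \<dots>, w\<^sub>k) = det (\<alpha>\<^sub>i w\<^sub>j)\<close>; the empty product is the constant function \<open>1\<close>.
\<close>

definition wedge :: "'a::euclidean_space set \<Rightarrow> ('a \<Rightarrow> 'a \<Rightarrow> real) list \<Rightarrow> 'a cform" where
  "wedge T as x ws =
     (if x \<in> T \<and> set ws \<subseteq> tangent T \<and> length ws = length as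
      then \<Sum>p | p permutes {..<length as}.
             of_int (sign p) * (\<Prod>i<length as. of_real ((as ! i) x (ws ! p i)))
      else 0)"

definition pullback ::
    "'a::euclidean_space set \<Rightarrow> ('a \<Rightarrow> 'a) \<Rightarrow> 'a cform \<Rightarrow> 'a cform" where
  "pullback T S \<omega> x ws =
     (if x \<in> T \<and> set ws \<subseteq> tangent T
      then \<omega> (S x) (map (frechet_derivative S (at x within T)) ws) else 0)"

definition constant_forms ::
    "nat \<Rightarrow> (nat \<Rightarrow> 'a::euclidean_space) \<Rightarrow> nat \<Rightarrow> 'a cform set" where
  "constant_forms n v k = cform.span
     {wedge (simplex_hull n v) (map (\<lambda>i. ext_deriv (simplex_hull n v) (barycentric n v i)) is)
        | is. length is = k \<and> set is \<subseteq> {0..n}}"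

definition form_basis :: "'a cform set \<Rightarrow> 'a cform set \<Rightarrow> bool" where
  "form_basis B V \<longleftrightarrow> \<not> cform.dependent B \<and> cform.span B = V"

text \<open>The finite set of forms is indexed by itself, so \<open>\<tau>\<close> permutes \<open>F\<close>.\<close>

definition C_invariant ::
    "nat \<Rightarrow> (nat \<Rightarrow> 'a::euclidean_space) \<Rightarrow> 'a cform set \<Rightarrow> bool" where
  "C_invariant n v F \<longleftrightarrow> finite F \<and>
     (\<forall>\<pi>. \<pi> permutes {0..n} \<longrightarrow>
        (\<exists>\<tau> c. \<tau> permutes F \<and>
           (\<forall>\<omega>\<in>F. cmod (c \<omega>) = 1 \<and>
              pullback (simplex_hull n v) (simplex_aut n v \<pi>) \<omega> = form_scale (c \<omega>) (\<tau> \<omega>))))"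

end

theory Submission
  imports Defs "HOL-Combinatorics.Permutations"
begin

text \<open>
  A \<open>\<complex>\<close>-invariant basis makes the representation of the symmetric group on \<open>V\<close>, the
  constant \<open>k\<close>-forms, monomial. The representation is irreducible, so the group permutes the lines
  of the basis transitively, and every permutation with nonzero trace on \<open>V\<close> has a conjugate in the
  stabiliser \<open>H\<close> of a given line. Assume \<open>0 < k < n\<close> and \<open>n \<ge> 4\<close>. The \<open>(n + 1)\<close>-cycle has trace
  \<open>\<plusminus>1\<close>, so \<open>H\<close> is transitive; the elements of cycle type \<open>(k, n - k, 1)\<close> and the \<open>a\<close>-cycles
  with \<open>min k (n - k) < a \<le> max k (n - k)\<close> also have nonzero trace, and they leave at most one
  kind of nontrivial block system for \<open>H\<close>: two blocks of size \<open>m\<close> with \<open>n + 1 = 2 m\<close> and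
  \<open>k \<in> {m - 1, m}\<close>.

  If \<open>n \<noteq> 2 k\<close>, then \<open>H\<close> contains a transposition. Being joined by a transposition in \<open>H\<close>
  is an \<open>H\<close>-invariant equivalence relation. If it has one class, all transpositions act diagonally
  and commute on \<open>V\<close>, which is impossible. If it has two blocks, a product of two disjoint
  transpositions can fix a line only with eigenvalue \<open>1\<close>, but its trace is negative. If \<open>n = 2 k\<close>
  and \<open>k \<ge> 3\<close>, then \<open>H\<close> contains a \<open>3\<close>-cycle, there are no blocks, and the same argument
  shows that all \<open>3\<close>-cycles commute on \<open>V\<close>.
\<close>

section \<open>Permutations\<close>

text \<open>A permutation fixing the index 0 acts on the basis \<open>d\<lambda>_J\<close>, with
  \<open>J\<close> a k-subset of \<open>{1..n}\<close>, by a signed permutation, so its trace is the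
  sum over the invariant sets \<open>J\<close> of the sign of its restriction to \<open>J\<close>.
  Except for the products of two transpositions and for single transpositions, the cycle types used
  make all these signs equal, so that the trace is nonzero as soon as an invariant set exists. The
  (n + 1)-cycle moves every index and needs the relation that the \<open>d\<lambda>_i\<close> sum to
  0.

  A nonzero trace puts only some conjugate into H, with no control over the conjugating permutation.
  Hence no transposition or 3-cycle is available at prescribed points, and the invariant equivalence
  relations serve to spread a single one over all of \<open>{0..n}\<close>. Once every line is
  stabilised by all of them, commutation contradicts that distinct permutations of
  \<open>{1..n}\<close> act differently on V when 0 < k < n.

  The pair k = 2, n = 4 escapes because there both a transposition and a 3-cycle have trace
  0.\<close>

abbreviation transp :: "'b \<Rightarrow> 'b \<Rightarrow> 'b \<Rightarrow> 'b" where
  "transp \<equiv> Transposition.transpose"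

text \<open>The increasing cycle on an interval, the identity unless \<open>a < b\<close>.
  Representatives of cycle types are built from intervals so that invariant sets can be found by
  climbing along successors.\<close>

definition cyc :: "nat \<Rightarrow> nat \<Rightarrow> nat \<Rightarrow> nat" where
  "cyc a b x = (if a \<le> x \<and> x < b then Suc x else if x = b \<and> a \<le> b then a else x)"

lemma cyc_refl [simp]: "cyc a a = id"
  by (simp add: fun_eq_iff cyc_def)

lemma cyc_Suc: "a \<le> b \<Longrightarrow> cyc a (Suc b) = cyc a b \<circ> transp b (Suc b)"
  by (auto simp: cyc_def Transposition.transpose_def fun_eq_iff)

lemma cyc_permutes: "a \<le> b \<Longrightarrow> cyc a b permutes {a..b}"
proof (induction rule: dec_induct)
  case base
  show ?case unfolding cyc_refl by (rule permutes_id)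
next
  case (step m)
  have "cyc a m permutes {a..Suc m}"
    using step(3) by (rule permutes_subset) auto
  moreover have "transp m (Suc m) permutes {a..Suc m}"
    using step(1) by (intro permutes_swap_id) auto
  ultimately show ?case
    unfolding cyc_Suc[OF step(1)] by (rule permutes_compose[rotated])
qed

lemma sign_cyc: "a \<le> b \<Longrightarrow> sign (cyc a b) = (- 1) ^ (b - a)"
proof (induction rule: dec_induct)
  case base
  then show ?case by (simp add: sign_id)
next
  case (step m)
  have "permutation (cyc a m)"
    using cyc_permutes[OF step(1)] by (rule permutes_imp_permutation[rotated]) simp
  then have "sign (cyc a (Suc m)) = sign (cyc a m) * sign (transp m (Suc m))"
    unfolding cyc_Suc[OF step(1)] by (rule sign_compose) (rule permutation_swap_id)
  then show ?case
    using step by (simp add: sign_swap_id Suc_diff_le)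
qed

text \<open>Closure under forward steps suffices: climb from \<open>x\<close> to \<open>b\<close>,
  wrap around to \<open>a\<close>, and climb again.\<close>

lemma cyc_invariant:
  assumes inv: "\<And>x. x \<in> J \<Longrightarrow> a \<le> x \<Longrightarrow> x \<le> b \<Longrightarrow> cyc a b x \<in> J"
    and x: "x \<in> J" "a \<le> x" "x \<le> b"
  shows "{a..b} \<subseteq> J"
proof -
  have up: "y \<in> J" if "z \<le> y" "z \<in> J" "a \<le> z" "y \<le> b" for y z
    using that
  proof (induction rule: dec_induct)
    case (step m)
    then have "m \<in> J" "a \<le> m" "m < b" by auto
    then show ?case using inv[of m] by (simp add: cyc_def)
  qed
  have "b \<in> J" using up[of x b] x by simp
  then have "a \<in> J" using inv[of b] x by (simp add: cyc_def)
  then show ?thesis using up[of a] by auto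
qed

lemma cyc_funpow: "i \<le> n \<Longrightarrow> (cyc 0 n ^^ i) 0 = i"
  by (induction i) (auto simp: cyc_def)

lemma cyc_permutes_superset: "a \<le> b \<Longrightarrow> {a..b} \<subseteq> S \<Longrightarrow> cyc a b permutes S"
  by (rule permutes_subset[OF cyc_permutes])

lemma permutes_conj:
  assumes "p permutes S" "s permutes S"
  shows "s \<circ> p \<circ> inv s permutes S"
  by (intro permutes_compose permutes_inv assms)

lemma conj_transpose:
  assumes "bij s"
  shows "s \<circ> transp a b \<circ> inv s = transp (s a) (s b)"
proof
  fix x
  have "s (inv s x) = x" "inv s x = y \<longleftrightarrow> x = s y" for y
    using assms by (metis bij_is_surj surj_f_inv_f, metis assms bij_inv_eq_iff)
  then show "(s \<circ> transp a b \<circ> inv s) x = transp (s a) (s b) x"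
    by (auto simp: Transposition.transpose_def)
qed

text \<open>The three-cycle \<open>x \<mapsto> y \<mapsto> z \<mapsto> x\<close>.\<close>

definition cyc3 :: "'b \<Rightarrow> 'b \<Rightarrow> 'b \<Rightarrow> 'b \<Rightarrow> 'b" where
  "cyc3 x y z = transp x y \<circ> transp y z"

lemma conj_cyc3:
  assumes "bij s"
  shows "s \<circ> cyc3 x y z \<circ> inv s = cyc3 (s x) (s y) (s z)"
proof -
  have "inv s \<circ> s = id" using assms by (simp add: bij_is_inj)
  then have "s \<circ> cyc3 x y z \<circ> inv s = (s \<circ> transp x y \<circ> inv s) \<circ> (s \<circ> transp y z \<circ> inv s)"
    unfolding cyc3_def by (metis comp_assoc comp_id)
  then show ?thesis by (simp add: conj_transpose[OF assms] cyc3_def)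
qed

lemma cyc_1_2: "cyc 1 2 = transp 1 2" and cyc_3_4: "cyc 3 4 = transp 3 4"
  by (auto simp: fun_eq_iff cyc_def Transposition.transpose_def)

lemma cyc_1_3: "cyc 1 3 = cyc3 1 2 3"
  by (auto simp: fun_eq_iff cyc_def cyc3_def Transposition.transpose_def)

lemma ex_permutes_image:
  assumes "A \<subseteq> S" "A' \<subseteq> S" "finite S" "card A = card A'"
  obtains \<pi> where "\<pi> permutes S" "\<pi> ` A = A'"
proof -
  have fin: "finite A" "finite A'" using assms finite_subset by blast+
  obtain f where f: "bij_betw f A A'"
    using finite_same_card_bij[OF fin assms(4)] by blast
  have "card (S - A) = card (S - A')"
    using assms fin by (simp add: card_Diff_subset)
  then obtain g where g: "bij_betw g (S - A) (S - A')"
    using finite_same_card_bij[of "S - A" "S - A'"] assms(3) by blast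
  define \<pi> where "\<pi> x = (if x \<in> A then f x else if x \<in> S then g x else x)" for x
  have "bij_betw \<pi> A A'" using f by (rule bij_betw_cong[THEN iffD1, rotated]) (simp add: \<pi>_def)
  moreover have "bij_betw \<pi> (S - A) (S - A')"
    using g by (rule bij_betw_cong[THEN iffD1, rotated]) (simp add: \<pi>_def)
  ultimately have "bij_betw \<pi> (A \<union> (S - A)) (A' \<union> (S - A'))"
    by (rule bij_betw_combine) auto
  then have "bij_betw \<pi> S S" using assms by (simp add: Un_absorb1)
  then have "\<pi> permutes S"
    using assms(1) by (intro bij_imp_permutes) (auto simp: \<pi>_def)
  moreover have "\<pi> ` A = A'" using \<open>bij_betw \<pi> A A'\<close> by (rule bij_betw_imp_surj_on)
  ultimately show ?thesis by (rule that)
qed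

text \<open>Serves to reduce permuting the indices of a wedge to permuting its factors, where
  antisymmetry applies.\<close>

lemma map_transpose_eq_permute_list:
  assumes "distinct xs" "i < length xs" "j < length xs"
  shows "map (transp (xs ! i) (xs ! j)) xs = permute_list (transp i j) xs"
proof (rule nth_equalityI)
  fix m assume "m < length (map (transp (xs ! i) (xs ! j)) xs)"
  then have m: "m < length xs" by simp
  have "transp i j permutes {..<length xs}"
    using assms by (intro permutes_swap_id) auto
  then show "map (transp (xs ! i) (xs ! j)) xs ! m = permute_list (transp i j) xs ! m"
    using m assms by (auto simp: permute_list_nth Transposition.transpose_def nth_eq_iff_index_eq)
qed simp

section \<open>Permutation groups and their invariant equivalence relations\<close>

locale perm_group =
  fixes S :: "'b set" and H :: "('b \<Rightarrow> 'b) set"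
  assumes permutes: "p \<in> H \<Longrightarrow> p permutes S"
    and id_in [simp]: "id \<in> H"
    and comp_in: "p \<in> H \<Longrightarrow> q \<in> H \<Longrightarrow> p \<circ> q \<in> H"
    and inv_in: "p \<in> H \<Longrightarrow> inv p \<in> H"
begin

lemma bij_in: "p \<in> H \<Longrightarrow> bij p"
  using permutes permutes_bij by blast

lemma conj_in: "p \<in> H \<Longrightarrow> q \<in> H \<Longrightarrow> p \<circ> q \<circ> inv p \<in> H"
  by (simp add: comp_in inv_in)

lemma in_S: "p \<in> H \<Longrightarrow> p x \<in> S \<longleftrightarrow> x \<in> S"
  using permutes permutes_in_image by metis

lemma funpow_in: "p \<in> H \<Longrightarrow> p ^^ i \<in> H"
  by (induction i) (auto intro: comp_in)

text \<open>The classes inside \<open>S\<close> form a system of blocks for \<open>H\<close>,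
  trivial systems included; nothing is demanded outside \<open>S\<close>.\<close>

definition invariant_equiv :: "('b \<Rightarrow> 'b \<Rightarrow> bool) \<Rightarrow> bool" where
  "invariant_equiv r \<longleftrightarrow> (\<forall>x\<in>S. r x x) \<and> (\<forall>x\<in>S. \<forall>y\<in>S. r x y \<longrightarrow> r y x) \<and>
    (\<forall>x\<in>S. \<forall>y\<in>S. \<forall>z\<in>S. r x y \<longrightarrow> r y z \<longrightarrow> r x z) \<and>
    (\<forall>p\<in>H. \<forall>x\<in>S. \<forall>y\<in>S. r x y \<longrightarrow> r (p x) (p y))"

lemma invariant_equivD:
  assumes "invariant_equiv r"
  shows "x \<in> S \<Longrightarrow> r x x" "x \<in> S \<Longrightarrow> y \<in> S \<Longrightarrow> r x y \<Longrightarrow> r y x"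
    "x \<in> S \<Longrightarrow> y \<in> S \<Longrightarrow> z \<in> S \<Longrightarrow> r x y \<Longrightarrow> r y z \<Longrightarrow> r x z"
    "p \<in> H \<Longrightarrow> x \<in> S \<Longrightarrow> y \<in> S \<Longrightarrow> r x y \<Longrightarrow> r (p x) (p y)"
  using assms unfolding invariant_equiv_def by blast+

text \<open>Transitivity and invariance are both conjugation: (x y)(y z)(x y) = (x z), and
  conjugating (x y) by \<open>p\<close> gives the transposition of \<open>p x\<close> and
  \<open>p y\<close>.\<close>

lemma invariant_equiv_transpose: "invariant_equiv (\<lambda>x y. x = y \<or> transp x y \<in> H)"
proof -
  have "x = z \<or> transp x z \<in> H"
    if xy: "x = y \<or> transp x y \<in> H" and yz: "y = z \<or> transp y z \<in> H" for x y z
  proof (cases "x = y \<or> y = z \<or> x = z")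
    case False
    then have "transp x y \<circ> transp y z \<circ> inv (transp x y) \<in> H"
      using xy yz by (intro conj_in) auto
    then have "transp (transp x y y) (transp x y z) \<in> H"
      by (simp only: conj_transpose[OF bij_transpose])
    moreover have "transp x y y = x" "transp x y z = z"
      using False by (auto simp: Transposition.transpose_def)
    ultimately show ?thesis by simp
  qed (use xy yz in auto)
  moreover have "p x = p y \<or> transp (p x) (p y) \<in> H" if "p \<in> H" "x = y \<or> transp x y \<in> H" for p x y
    using that conj_in[OF that(1), of "transp x y"] conj_transpose[OF bij_in[OF that(1)], of x y] by auto
  ultimately show ?thesis
    unfolding invariant_equiv_def
    by (intro conjI ballI impI) (blast, simp add: transpose_commute disj_commute eq_commute, blast+)
qed

text \<open>Distinctness is demanded because \<open>cyc3\<close> degenerates to a transposition or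
  the identity when two of its arguments coincide.\<close>

definition three :: "'b \<Rightarrow> 'b \<Rightarrow> 'b \<Rightarrow> bool" where
  "three x y z \<longleftrightarrow> x \<noteq> y \<and> y \<noteq> z \<and> x \<noteq> z \<and> cyc3 x y z \<in> H"

lemma three_rotate: "three x y z \<Longrightarrow> three y z x"
proof -
  assume "three x y z"
  moreover from this have "cyc3 y z x = cyc3 x y z"
    by (auto simp: three_def cyc3_def Transposition.transpose_def fun_eq_iff)
  ultimately show ?thesis by (auto simp: three_def)
qed

text \<open>The square of a 3-cycle is its inverse. Together with rotation this makes
  \<open>three\<close> symmetric in its arguments.\<close>

lemma three_flip: "three x y z \<Longrightarrow> three y x z"
proof -
  assume *: "three x y z"
  then have "cyc3 x y z \<circ> cyc3 x y z \<in> H" by (auto simp: three_def comp_in)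
  moreover have "cyc3 x y z \<circ> cyc3 x y z = cyc3 y x z"
    using * by (auto simp: three_def cyc3_def Transposition.transpose_def fun_eq_iff)
  ultimately show ?thesis using * by (auto simp: three_def)
qed

lemma three_image:
  assumes "p \<in> H" "three x y z"
  shows "three (p x) (p y) (p z)"
proof -
  have "p a = p b \<longleftrightarrow> a = b" for a b
    using bij_in[OF assms(1)] by (metis bij_pointE)
  then show ?thesis
    using assms conj_in[OF assms(1), of "cyc3 x y z"] conj_cyc3[OF bij_in[OF assms(1)], of x y z]
    by (auto simp: three_def)
qed

lemma three_conj:
  assumes "three a b c" "three x y z"
  shows "three (cyc3 a b c x) (cyc3 a b c y) (cyc3 a b c z)"
  using three_image[of "cyc3 a b c"] assms by (auto simp: three_def)

lemma cyc3_simps: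
  "x \<noteq> y \<Longrightarrow> y \<noteq> z \<Longrightarrow> x \<noteq> z \<Longrightarrow> cyc3 x y z x = y"
  "x \<noteq> y \<Longrightarrow> y \<noteq> z \<Longrightarrow> x \<noteq> z \<Longrightarrow> cyc3 x y z y = z"
  "x \<noteq> y \<Longrightarrow> y \<noteq> z \<Longrightarrow> x \<noteq> z \<Longrightarrow> cyc3 x y z z = x"
  "w \<noteq> x \<Longrightarrow> w \<noteq> y \<Longrightarrow> w \<noteq> z \<Longrightarrow> cyc3 x y z w = w"
  by (auto simp: cyc3_def Transposition.transpose_def)

text \<open>Conjugating (x y z) by (y u w) fixes \<open>x\<close> and sends \<open>y\<close> to
  \<open>u\<close>, unless \<open>w = x\<close>, in which case (y u w) itself already joins
  \<open>x\<close> and \<open>u\<close>.\<close>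

lemma three_trans:
  assumes "three x y z" "three y u w" "x \<noteq> u"
  shows "\<exists>t. three x u t"
proof (cases "x = w")
  case True
  then show ?thesis using three_rotate three_flip assms(2) by blast
next
  case False
  have d: "y \<noteq> u" "u \<noteq> w" "y \<noteq> w" "x \<noteq> y" using assms(1,2) by (auto simp: three_def)
  have "three (cyc3 y u w x) (cyc3 y u w y) (cyc3 y u w z)"
    using assms by (intro three_conj)
  then have "three x u (cyc3 y u w z)"
    using d False assms(3) by (simp add: cyc3_simps)
  then show ?thesis by blast
qed

lemma invariant_equiv_three: "invariant_equiv (\<lambda>x y. x = y \<or> (\<exists>z. three x y z))"
  unfolding invariant_equiv_def
proof (intro conjI ballI impI)
  show "y = x \<or> (\<exists>z. three y x z)" if "x = y \<or> (\<exists>z. three x y z)" for x y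
    using that three_flip by blast
  show "x = z \<or> (\<exists>t. three x z t)"
    if "x = y \<or> (\<exists>t. three x y t)" "y = z \<or> (\<exists>t. three y z t)" for x y z
    using that three_trans[of x y _ z] by blast
  show "p x = p y \<or> (\<exists>z. three (p x) (p y) z)" if "p \<in> H" "x = y \<or> (\<exists>z. three x y z)" for p x y
    using that three_image by blast
qed simp

text \<open>Starting from some (x y w), the point \<open>w\<close> has to be replaced by
  \<open>z\<close>. Conjugation by a 3-cycle (w z u) does this if \<open>u\<close> avoids
  \<open>x\<close> and \<open>y\<close>; otherwise both 3-cycles live on the four points x, y, w, z,
  and conjugating them by one another gives the claim.\<close>

lemma three_all:
  assumes "\<And>x y. x \<in> S \<Longrightarrow> y \<in> S \<Longrightarrow> x \<noteq> y \<Longrightarrow> \<exists>z. three x y z"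
    and "x \<in> S" "y \<in> S" "z \<in> S" "x \<noteq> y" "y \<noteq> z" "x \<noteq> z"
  shows "three x y z"
proof -
  obtain w where w: "three x y w" using assms by blast
  show ?thesis
  proof (cases "w = z")
    case False
    have "w \<in> S"
    proof (rule ccontr)
      assume "w \<notin> S"
      then have "cyc3 x y w w = w"
        using permutes permutes_not_in w unfolding three_def by metis
      then show False using w by (auto simp: three_def cyc3_simps)
    qed
    then obtain u where u: "three w z u" using assms False by blast
    have d: "x \<noteq> y" "y \<noteq> w" "x \<noteq> w" "w \<noteq> z" "z \<noteq> u" "w \<noteq> u"
      using w u by (auto simp: three_def)
    have c: "three (cyc3 w z u x) (cyc3 w z u y) (cyc3 w z u w)"
      using w u by (intro three_conj)
    consider "u = x" | "u = y" | "u \<noteq> x" "u \<noteq> y" by blast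
    then show ?thesis
    proof cases
      case 1
      have "three z x w" using u 1 three_rotate by blast
      then have "three x z w" by (rule three_flip)
      then have "three (cyc3 x z w x) (cyc3 x z w y) (cyc3 x z w w)"
        using w by (intro three_conj)
      then have "three z y x" using d assms by (simp add: cyc3_simps)
      then show ?thesis using three_rotate three_flip by blast
    next
      case 2
      have "three (cyc3 w z y x) (cyc3 w z y y) (cyc3 w z y w)" using c 2 by simp
      then have "three x w z" using d 2 assms by (simp add: cyc3_simps)
      have "three y w z" using u 2 three_rotate by blast
      then have "three (cyc3 y w z x) (cyc3 y w z w) (cyc3 y w z z)"
        using \<open>three x w z\<close> by (intro three_conj)
      then have "three x z y" using d 2 assms by (simp add: cyc3_simps)
      then show ?thesis using three_rotate three_flip by blast
    next
      case 3
      then have "three x y z" using c d assms by (simp add: cyc3_simps)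
      then show ?thesis .
    qed
  qed (use w in auto)
qed

end

lemma (in perm_group) invariant_equiv_class_card:
  assumes r: "invariant_equiv r" and "finite S" and "p \<in> H" "x \<in> S"
  shows "card {y \<in> S. r (p x) y} = card {y \<in> S. r x y}"
proof -
  have "p ` {y \<in> S. r x y} = {y \<in> S. r (p x) y}"
  proof
    show "p ` {y \<in> S. r x y} \<subseteq> {y \<in> S. r (p x) y}"
      using invariant_equivD(4)[OF r] assms in_S by auto
    show "{y \<in> S. r (p x) y} \<subseteq> p ` {y \<in> S. r x y}"
    proof clarify
      fix y assume y: "y \<in> S" "r (p x) y"
      have "r (inv p (p x)) (inv p y)"
        using invariant_equivD(4)[OF r inv_in[OF assms(3)]] y assms in_S by blast
      moreover have "inv p (p x) = x" "p (inv p y) = y"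
        using permutes_inverses[OF permutes[OF assms(3)]] by auto
      moreover have "inv p y \<in> S" using in_S[OF inv_in[OF assms(3)]] y by simp
      ultimately show "y \<in> p ` {y \<in> S. r x y}" by force
    qed
  qed
  moreover have "inj_on p {y \<in> S. r x y}"
    using permutes_inj[OF permutes[OF assms(3)]] by (auto simp: inj_on_def inj_def)
  ultimately show ?thesis by (metis card_image)
qed

lemma card_equiv_classes_dvd:
  assumes "finite S"
    and refl: "\<And>x. x \<in> S \<Longrightarrow> r x x"
    and sym: "\<And>x y. x \<in> S \<Longrightarrow> y \<in> S \<Longrightarrow> r x y \<Longrightarrow> r y x"
    and trans: "\<And>x y z. x \<in> S \<Longrightarrow> y \<in> S \<Longrightarrow> z \<in> S \<Longrightarrow> r x y \<Longrightarrow> r y z \<Longrightarrow> r x z"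
    and card: "\<And>x. x \<in> S \<Longrightarrow> card {y \<in> S. r x y} = m"
  shows "m dvd card S"
proof -
  let ?c = "\<lambda>x. {y \<in> S. r x y}"
  have "?c x \<inter> ?c y = {}" if "x \<in> S" "y \<in> S" "?c x \<noteq> ?c y" for x y
  proof (rule ccontr)
    assume "?c x \<inter> ?c y \<noteq> {}"
    then obtain z where "z \<in> S" "r x z" "r y z" by blast
    then have "r x y" "r y x" using sym trans that by blast+
    then have "?c x = ?c y" using trans that by blast
    with that show False by simp
  qed
  moreover have "\<Union> (?c ` S) = S"
    using refl by auto
  ultimately show ?thesis
    using dvd_partition[of "?c ` S" m] assms(1) card by (auto simp: image_iff)
qed

section \<open>Block systems compatible with prescribed cycle types\<close>

locale perm_group_nat = perm_group "{0..n}" H for n :: nat and H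
begin

text \<open>The powers of the conjugated (n + 1)-cycle carry \<open>s 0\<close> to every
  point.\<close>

lemma transitive:
  assumes s: "s permutes {0..n}" and h: "s \<circ> cyc 0 n \<circ> inv s \<in> H"
    and xy: "x \<in> {0..n}" "y \<in> {0..n}"
  obtains p where "p \<in> H" "p x = y"
proof -
  define q where "q i = (s \<circ> cyc 0 n \<circ> inv s) ^^ i" for i
  have q: "q i \<in> H" for i
    unfolding q_def by (rule funpow_in[OF h])
  have q0: "q i (s 0) = s ((cyc 0 n ^^ i) 0)" for i
    by (induction i) (simp_all add: q_def permutes_inverses[OF s])
  have "inv s z \<le> n \<and> s (inv s z) = z" if "z \<in> {0..n}" for z
    using that permutes_in_image[OF permutes_inv[OF s], of z] permutes_inverses[OF s] by simp
  then have z: "q (inv s z) (s 0) = z" if "z \<in> {0..n}" for z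
    using that by (simp add: q0 cyc_funpow)
  have "inv (q (inv s x)) x = s 0"
    using z[OF xy(1)] permutes_inverses(2)[OF permutes[OF q]] by metis
  then have "(q (inv s y) \<circ> inv (q (inv s x))) x = y"
    using z[OF xy(2)] by simp
  then show ?thesis using that comp_in[OF q inv_in[OF q]] by blast
qed

text \<open>The relation pulled back along \<open>s\<close> is invariant under \<open>g\<close>
  itself. So blocks can be analysed with \<open>g\<close> in its standard form on intervals although
  only a conjugate of it lies in \<open>H\<close>.\<close>

lemma conj_equiv:
  assumes r: "invariant_equiv r" and s: "s permutes {0..n}" and h: "s \<circ> g \<circ> inv s \<in> H"
    and xy: "x \<in> {0..n}" "y \<in> {0..n}"
  shows "r (s (g x)) (s (g y)) \<longleftrightarrow> r (s x) (s y)"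
proof -
  let ?h = "s \<circ> g \<circ> inv s"
  have S: "s x \<in> {0..n}" "s y \<in> {0..n}"
    using xy permutes_in_image[OF s] by simp_all
  have h_eq: "?h (s z) = s (g z)" for z
    by (simp add: permutes_inverses[OF s])
  have "r (?h (s x)) (?h (s y))" if "r (s x) (s y)"
    using invariant_equivD(4)[OF r h S that] .
  moreover have "r (inv ?h (?h (s x))) (inv ?h (?h (s y)))" if "r (?h (s x)) (?h (s y))"
    using invariant_equivD(4)[OF r inv_in[OF h] _ _ that] in_S[OF h] S by blast
  ultimately show ?thesis
    unfolding h_eq[symmetric] by (auto simp only: permutes_inverses(2)[OF permutes[OF h]])
qed

text \<open>By transitivity all blocks have one size \<open>m\<close>, a divisor of n + 1. The block
  through the fixed point of the element of type (k, n - k, 1) is a union of orbits of that element,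
  so a proper block has size min k (n - k) + 1. An (m + 1)-cycle would force two disjoint blocks of
  size m >= 2 into its m + 1 moved points; hence max k (n - k) is at most \<open>m\<close>, which
  leaves n + 1 = 2 m.\<close>

lemma block_dichotomy:
  assumes r: "invariant_equiv r" and nontriv: "x0 \<in> {0..n}" "y0 \<in> {0..n}" "x0 \<noteq> y0" "r x0 y0"
    and k: "0 < k" "k < n"
    and s0: "s0 permutes {0..n}" "s0 \<circ> cyc 0 n \<circ> inv s0 \<in> H"
    and s1: "s1 permutes {0..n}" "s1 \<circ> (cyc 1 k \<circ> cyc (Suc k) n) \<circ> inv s1 \<in> H"
    and s2: "\<And>a. min k (n - k) < a \<Longrightarrow> a \<le> max k (n - k) \<Longrightarrow>
      \<exists>s. s permutes {0..n} \<and> s \<circ> cyc 1 a \<circ> inv s \<in> H"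
  obtains "\<And>x y. x \<in> {0..n} \<Longrightarrow> y \<in> {0..n} \<Longrightarrow> r x y"
  | m where "n + 1 = 2 * m" "k = m \<or> k + 1 = m" "\<And>x. x \<in> {0..n} \<Longrightarrow> card {y \<in> {0..n}. r x y} = m"
proof -
  let ?S = "{0..n}"
  note req = invariant_equivD[OF r]
  define m where "m = card {y \<in> ?S. r 0 y}"
  have card_m: "card {y \<in> ?S. r x y} = m" if x: "x \<in> ?S" for x
  proof -
    obtain p where "p \<in> H" "p 0 = x" using transitive[OF s0, of 0 x] x by auto
    then show ?thesis using invariant_equiv_class_card[OF r _, of p 0] by (simp add: m_def)
  qed
  have "m dvd card ?S"
    by (rule card_equiv_classes_dvd[of ?S r]) (use req(1-3) card_m in blast)+
  then have dvd: "m dvd n + 1" by simp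
  have m2: "2 \<le> m"
  proof -
    have "card {x0, y0} \<le> card {y \<in> ?S. r x0 y}"
      using nontriv req(1) by (intro card_mono) auto
    then show ?thesis using nontriv card_m by simp
  qed
  have card_conj: "card {y \<in> ?S. r (s x) (s y)} = m" if s: "s permutes ?S" and x: "x \<in> ?S" for s x
  proof -
    have sx: "s x \<in> ?S" using x permutes_in_image[OF s] by simp
    have "s ` {y \<in> ?S. r (s x) (s y)} = {y \<in> ?S. r (s x) y}" (is "_ ` ?A = ?B")
    proof
      show "s ` ?A \<subseteq> ?B" using permutes_in_image[OF s] by auto
      show "?B \<subseteq> s ` ?A"
      proof
        fix y assume y: "y \<in> ?B"
        then have "inv s y \<in> ?S" using permutes_in_image[OF permutes_inv[OF s], of y] by simp
        moreover have "s (inv s y) = y" using permutes_inverses[OF s] by simp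
        ultimately show "y \<in> s ` ?A" using y by force
      qed
    qed
    moreover have "inj_on s ?A" using permutes_inj_on[OF s] .
    ultimately show ?thesis using card_m[OF sx] by (metis card_image)
  qed
  define C where "C = {y \<in> ?S. r (s1 0) (s1 y)}"
  have C0: "0 \<in> C" using req(1) permutes_in_image[OF s1(1)] by (simp add: C_def)
  have cardC: "card C = m" unfolding C_def by (rule card_conj[OF s1(1)]) simp
  have gC: "(cyc 1 k \<circ> cyc (Suc k) n) x \<in> C" if x: "x \<in> C" for x
  proof -
    let ?g = "cyc 1 k \<circ> cyc (Suc k) n"
    have "?g 0 = 0" using k by (simp add: cyc_def)
    moreover have "?g x \<in> ?S"
      using x k by (auto simp: cyc_def C_def)
    ultimately show ?thesis
      using conj_equiv[OF r s1, of 0 x] x by (simp add: C_def)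
  qed
  have C1: "{1..k} \<subseteq> C" if "x \<in> C" "1 \<le> x" "x \<le> k" for x
  proof (rule cyc_invariant[of C 1 k x, OF _ that])
    fix y assume "y \<in> C" "1 \<le> y" "y \<le> k"
    moreover from this have "cyc (Suc k) n y = y" using k by (simp add: cyc_def)
    ultimately show "cyc 1 k y \<in> C" using gC[of y] by simp
  qed
  have C2: "{Suc k..n} \<subseteq> C" if "x \<in> C" "Suc k \<le> x" "x \<le> n" for x
  proof (rule cyc_invariant[of C "Suc k" n x, OF _ that])
    fix y assume "y \<in> C" "Suc k \<le> y" "y \<le> n"
    moreover from this have "cyc 1 k (cyc (Suc k) n y) = cyc (Suc k) n y"
      by (simp add: cyc_def)
    ultimately show "cyc (Suc k) n y \<in> C" using gC[of y] by simp
  qed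
  have CS: "C \<subseteq> ?S" by (auto simp: C_def)
  \<comment> \<open>A proper divisor of n + 1 is at most half of it. This selects the smaller of the
    two candidate sizes k + 1 and n - k + 1.\<close>
  have half: "2 * m \<le> n + 1" if "m < n + 1"
  proof -
    obtain q where q: "n + 1 = m * q" using dvd by blast
    with that m2 have "q \<noteq> 0" "q \<noteq> 1" by (auto intro!: notI)
    then have "2 \<le> q" by simp
    then have "m * 2 \<le> m * q" by (rule mult_le_mono2)
    then show ?thesis using q by simp
  qed
  consider "C = ?S" | "m = min k (n - k) + 1" "2 * m \<le> n + 1"
  proof -
    consider "C \<inter> {1..k} = {}" "C \<inter> {Suc k..n} = {}" | "{1..k} \<subseteq> C" "C \<inter> {Suc k..n} = {}"
      | "C \<inter> {1..k} = {}" "{Suc k..n} \<subseteq> C" | "{1..k} \<subseteq> C" "{Suc k..n} \<subseteq> C"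
    proof -
      have "{1..k} \<subseteq> C \<or> C \<inter> {1..k} = {}" using C1 by fastforce
      moreover have "{Suc k..n} \<subseteq> C \<or> C \<inter> {Suc k..n} = {}" using C2 by fastforce
      ultimately show ?thesis using that by blast
    qed
    then show ?thesis
    proof cases
      case 1
      have "C \<subseteq> {0}"
      proof
        fix x assume "x \<in> C"
        then have "x \<notin> {1..k}" "x \<notin> {Suc k..n}" "x \<le> n" using 1 CS by auto
        then show "x \<in> {0}" by auto
      qed
      then have "card C \<le> 1" using card_mono[of "{0::nat}" C] by simp
      then show ?thesis using cardC m2 by simp
    next
      case 2
      have "C = {0..k}"
      proof
        show "C \<subseteq> {0..k}" using 2 CS by fastforce
        show "{0..k} \<subseteq> C"
        proof
          fix x assume "x \<in> {0..k}"
          then show "x \<in> C" using 2 C0 by (cases "x = 0") auto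
        qed
      qed
      then have "m = k + 1" using cardC by simp
      then show ?thesis using k half that(2) by simp
    next
      case 3
      have "C = insert 0 {Suc k..n}"
      proof
        show "C \<subseteq> insert 0 {Suc k..n}"
        proof
          fix x assume "x \<in> C"
          then have "x \<notin> {1..k}" "x \<le> n" using 3 CS by auto
          then show "x \<in> insert 0 {Suc k..n}" by auto
        qed
        show "insert 0 {Suc k..n} \<subseteq> C" using 3 C0 by auto
      qed
      then have "m = n - k + 1" using cardC by simp
      then show ?thesis using k half that(2) by simp
    next
      case 4
      have "x \<in> C" if "x \<le> n" for x
        using that C0 4 by (cases "x = 0"; cases "x \<le> k") auto
      then have "C = ?S" using CS by auto
      then show ?thesis by (rule that(1))
    qed
  qed
  then show ?thesis
  proof cases
    case 1
    have rel: "r (s1 0) y" if y: "y \<in> ?S" for y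
    proof -
      have "inv s1 y \<in> C" using 1 y permutes_in_image[OF permutes_inv[OF s1(1)], of y] by simp
      then show ?thesis using permutes_inverses[OF s1(1)] by (simp add: C_def)
    qed
    have s10: "s1 0 \<in> ?S" using permutes_in_image[OF s1(1)] by simp
    show ?thesis
    proof (rule that(1))
      fix x y assume xy: "x \<in> ?S" "y \<in> ?S"
      show "r x y"
        by (rule req(3)[OF xy(1) s10 xy(2) req(2)[OF s10 xy(1) rel[OF xy(1)]] rel[OF xy(2)]])
    qed
  next
    case 2
    have "max k (n - k) \<le> m"
    proof (rule ccontr)
      assume "\<not> max k (n - k) \<le> m"
      then have m1: "m + 1 \<le> max k (n - k)" by linarith
      have "min k (n - k) < m + 1" using 2(1) by linarith
      then obtain s where s: "s permutes ?S" "s \<circ> cyc 1 (m + 1) \<circ> inv s \<in> H"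
        using s2[OF _ m1] by blast
      let ?c = "cyc 1 (m + 1)"
      have n: "m + 1 \<le> n" using m1 k by linarith
      define D where "D x = {y \<in> ?S. r (s x) (s y)}" for x
      have cardD: "card (D x) = m" if "x \<in> ?S" for x
        unfolding D_def by (rule card_conj[OF s(1) that])
      have sS: "s x \<in> ?S \<longleftrightarrow> x \<in> ?S" for x by (rule permutes_in_image[OF s(1)])
      have c_inv: "r (s (?c x)) (s (?c y)) \<longleftrightarrow> r (s x) (s y)" if "x \<in> ?S" "y \<in> ?S" for x y
        by (rule conj_equiv[OF r s that])
      have qs: "r (s b) (s a)" if "a \<in> ?S" "b \<in> ?S" "r (s a) (s b)" for a b
        using req(2)[of "s a" "s b"] that sS by blast
      have qt: "r (s a) (s d)" if "a \<in> ?S" "b \<in> ?S" "d \<in> ?S" "r (s a) (s b)" "r (s b) (s d)" for a b d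
        using req(3)[of "s a" "s b" "s d"] that sS by blast
      have "1 \<in> D 1" using n req(1) sS by (simp add: D_def)
      \<comment> \<open>A block of size \<open>m\<close> cannot contain all m + 1 moved points, so
        the cycle leaves the block of 1 at some \<open>x\<close>.\<close>
      have "\<not> {1..m + 1} \<subseteq> D 1"
      proof
        assume "{1..m + 1} \<subseteq> D 1"
        then have "card {1..m + 1} \<le> card (D 1)" by (intro card_mono) (auto simp: D_def)
        then show False using cardD[of 1] n by simp
      qed
      then obtain x where x: "x \<in> D 1" "1 \<le> x" "x \<le> m + 1" "?c x \<notin> D 1"
        using cyc_invariant[of "D 1" 1 "m + 1" 1] \<open>1 \<in> D 1\<close> by auto
      have xS: "x \<in> ?S" "1 \<in> ?S" using x n by auto
      have cx: "1 \<le> ?c x" "?c x \<le> m + 1" "?c x \<in> ?S" using x(2,3) n by (auto simp: cyc_def)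
      have nr: "\<not> r (s (?c x)) (s x)"
      proof
        assume "r (s (?c x)) (s x)"
        then have "r (s 1) (s (?c x))"
          using x(1) qs[OF cx(3) xS(1)] qt[OF xS(2) xS(1) cx(3)] by (simp add: D_def)
        then show False using x(4) cx(3) by (simp add: D_def)
      qed
      have Dx: "D 1 = D x"
      proof -
        have 1: "r (s 1) (s x)" using x(1) by (simp add: D_def)
        show ?thesis
          using qt[OF xS(2,1) _ 1] qt[OF xS(1,2) _ qs[OF xS(2,1) 1]] by (auto simp: D_def)
      qed
      \<comment> \<open>A block containing a fixed point of the cycle is mapped to itself. The
        blocks of \<open>x\<close> and of its image differ, so neither contains a fixed
        point.\<close>
      have fix_free: "y \<in> {1..m + 1}" if y: "y \<in> D x \<or> y \<in> D (?c x)" for y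
      proof (rule ccontr)
        assume "y \<notin> {1..m + 1}"
        then have cy: "?c y = y" by (auto simp: cyc_def)
        have yS: "y \<in> ?S" using y by (auto simp: D_def)
        have "r (s x) (s y) \<longleftrightarrow> r (s (?c x)) (s y)"
          using c_inv[OF xS(1) yS] cy by simp
        then have "r (s x) (s y)" "r (s (?c x)) (s y)" using y by (auto simp: D_def)
        then have "r (s (?c x)) (s x)"
          using qt[OF cx(3) yS xS(1)] qs[OF xS(1) yS] by simp
        then show False using nr by simp
      qed
      have disj: "D x \<inter> D (?c x) = {}"
      proof (rule ccontr)
        assume "D x \<inter> D (?c x) \<noteq> {}"
        then obtain z where "z \<in> ?S" "r (s x) (s z)" "r (s (?c x)) (s z)" by (auto simp: D_def)
        then show False using nr qt[OF cx(3) _ xS(1), of z] qs[OF xS(1), of z] by simp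
      qed
      have "card (D x \<union> D (?c x)) \<le> card {1..m + 1}"
        using fix_free by (intro card_mono) auto
      moreover have "card (D x \<union> D (?c x)) = m + m"
        using disj cardD xS(1) cx(3) by (subst card_Un_disjoint) (auto simp: D_def)
      ultimately show False using m2 by simp
    qed
    then have "n + 1 = 2 * m" "k = m \<or> k + 1 = m" using 2 k by linarith+
    then show ?thesis using that(2) card_m by simp
  qed
qed

end

section \<open>Constant forms on a simplex\<close>

text \<open>\<open>T\<close> may have empty interior, so a derivative within \<open>T\<close> is not
  unique as a linear map. The segment from \<open>x\<close> to \<open>y\<close> stays in
  \<open>T\<close>, and along it the claim is uniqueness in one variable.\<close>

lemma has_derivative_within_convex_unique:
  fixes f :: "'a::real_normed_vector \<Rightarrow> 'b::real_normed_vector"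
  assumes "convex T" "x \<in> T" "y \<in> T"
    and "(f has_derivative F) (at x within T)" "(f has_derivative G) (at x within T)"
  shows "F (y - x) = G (y - x)"
proof -
  let ?p = "\<lambda>t::real. x + t *\<^sub>R (y - x)"
  have sub: "?p ` {0..1} \<subseteq> T"
  proof
    fix z assume "z \<in> ?p ` {0..1}"
    then obtain t where t: "0 \<le> t" "t \<le> 1" "z = (1 - t) *\<^sub>R x + t *\<^sub>R y"
      by (auto simp: algebra_simps)
    then show "z \<in> T"
      using assms(1-3) by (auto simp: convex_alt)
  qed
  have p: "(?p has_derivative (\<lambda>t. t *\<^sub>R (y - x))) (at 0 within {0..1})"
    by (auto intro!: derivative_eq_intros)
  have D: "((\<lambda>t. f (?p t)) has_vector_derivative H (y - x)) (at 0 within cbox 0 1)"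
    if H: "(f has_derivative H) (at x within T)" for H
  proof -
    have "((\<lambda>t. f (?p t)) has_derivative (\<lambda>t. H (t *\<^sub>R (y - x)))) (at 0 within {0..1})"
      using has_derivative_in_compose[OF p, of f H] has_derivative_subset[OF H sub] by simp
    then show ?thesis
      using has_derivative_linear[OF H]
      by (simp add: has_vector_derivative_def linear_scale)
  qed
  show ?thesis
    by (rule vector_derivative_unique_within_closed_interval[OF _ _ D[OF assms(4)] D[OF assms(5)]]) auto
qed

text \<open>\<open>frechet_derivative\<close> picks an arbitrary derivative within \<open>T\<close>.
  All derivatives agree on the directions y - x, hence on the differences y - z = (y - x) - (z - x)
  and on their span.\<close>

lemma frechet_derivative_tangent:
  fixes f :: "'a::euclidean_space \<Rightarrow> 'b::real_normed_vector"
  assumes "convex T" "x \<in> T" "w \<in> tangent T" "(f has_derivative g) (at x within T)"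
  shows "frechet_derivative f (at x within T) w = g w"
proof -
  let ?F = "frechet_derivative f (at x within T)"
  have F: "(f has_derivative ?F) (at x within T)"
    using assms(4) frechet_derivative_works differentiable_def by blast
  have lin: "linear ?F" "linear g"
    using F assms(4) has_derivative_linear by blast+
  have eq: "?F (y - x) = g (y - x)" if "y \<in> T" for y
    by (rule has_derivative_within_convex_unique[OF assms(1,2) that F assms(4)])
  have "?F w = g w" if "w \<in> {y - z |y z. y \<in> T \<and> z \<in> T}" for w
  proof -
    from that obtain y z where "w = y - z" "y \<in> T" "z \<in> T" by auto
    then have w: "w = (y - x) - (z - x)" and yz: "y \<in> T" "z \<in> T" by auto
    show ?thesis
      unfolding w using eq[OF yz(1)] eq[OF yz(2)]
      by (simp only: linear_diff[OF lin(1), of "y - x"] linear_diff[OF lin(2), of "y - x"])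
  qed
  then show ?thesis
    using assms(3) linear_eq_on_span[OF lin] unfolding tangent_def by blast
qed

(* Goals at function type are eta-expanded by unification; these rules would then rewrite below
   the abstraction and hide the vector space structure. *)
declare plus_fun_apply [simp del] zero_fun_apply [simp del]

lemma sum_form_apply: "(\<Sum>i\<in>A. f i) x ws = (\<Sum>i\<in>A. (f i :: 'a cform) x ws)"
  by (induction A rule: infinite_finite_induct) (auto simp: plus_fun_apply zero_fun_apply)

section \<open>Edges, tangent vectors and the differentials of the barycentric coordinates\<close>

locale simplex =
  fixes n :: nat and v :: "nat \<Rightarrow> 'a::euclidean_space"
  assumes simplex_vertices: "simplex_vertices n v"
begin

abbreviation T where "T \<equiv> simplex_hull n v"

lemma convex_T [simp]: "convex T"
  by (simp add: simplex_hull_def)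

lemma vertex_in_T [simp]: "j \<le> n \<Longrightarrow> v j \<in> T"
  by (auto simp: simplex_hull_def intro: hull_inc)

lemma vertex_diff_tangent [simp]: "i \<le> n \<Longrightarrow> j \<le> n \<Longrightarrow> v i - v j \<in> tangent T"
  unfolding tangent_def by (rule span_base) (use vertex_in_T[of i] vertex_in_T[of j] in blast)

lemma edges_independent:
  "inj_on (\<lambda>j. v j - v 0) {1..n}" "independent ((\<lambda>j. v j - v 0) ` {1..n})"
proof -
  have inj: "inj_on v {0..n}" and ind: "\<not> affine_dependent (v ` {0..n})"
    using simplex_vertices by (auto simp: simplex_vertices_def)
  show "inj_on (\<lambda>j. v j - v 0) {1..n}"
    using inj by (auto simp: inj_on_def)
  have "{0..n} = insert 0 {1..n}" by auto
  then have eq: "v ` {0..n} = insert (v 0) (v ` {1..n})" by simp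
  have "v 0 \<notin> v ` {1..n}"
    using inj by (force simp: inj_on_def)
  then have "\<not> dependent ((\<lambda>x. - v 0 + x) ` (v ` {1..n}))"
    using ind affine_dependent_iff_dependent eq by metis
  then show "independent ((\<lambda>j. v j - v 0) ` {1..n})"
    by (simp add: image_image)
qed

lemma T_affine_induct [consumes 1, case_names vertex convex]:
  assumes "x \<in> T"
    and "\<And>j. j \<le> n \<Longrightarrow> P (v j)"
    and "\<And>x y u. x \<in> T \<Longrightarrow> y \<in> T \<Longrightarrow> 0 \<le> u \<Longrightarrow> u \<le> 1 \<Longrightarrow> P x \<Longrightarrow> P y
      \<Longrightarrow> P ((1 - u) *\<^sub>R x + u *\<^sub>R y)"
  shows "P x"
proof -
  have "convex {x \<in> T. P x}"
    using assms(3) convex_T by (auto simp: convex_alt)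
  then have "T \<subseteq> {x \<in> T. P x}"
    unfolding simplex_hull_def using assms(2) vertex_in_T
    by (intro hull_minimal) (auto simp flip: simplex_hull_def)
  then show ?thesis using assms(1) by auto
qed

lemma tangent_eq: "tangent T = span ((\<lambda>j. v j - v 0) ` {1..n})" (is "_ = span ?S")
proof
  have *: "x - v 0 \<in> span ?S" if "x \<in> T" for x
    using that
  proof (induction rule: T_affine_induct)
    case (vertex j)
    then show ?case by (cases "j = 0") (auto intro: span_base simp: span_0)
  next
    case (convex x y u)
    have "(1 - u) *\<^sub>R x + u *\<^sub>R y - v 0 = (1 - u) *\<^sub>R (x - v 0) + u *\<^sub>R (y - v 0)"
      by (simp add: algebra_simps)
    then show ?case using convex by (simp add: span_add span_scale)
  qed
  show "tangent T \<subseteq> span ?S"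
    unfolding tangent_def
  proof (rule span_minimal)
    show "{x - y |x y. x \<in> T \<and> y \<in> T} \<subseteq> span ?S"
    proof clarify
      fix x y assume "x \<in> T" "y \<in> T"
      then have "(x - v 0) - (y - v 0) \<in> span ?S" by (intro span_diff *)
      then show "x - y \<in> span ?S" by simp
    qed
  qed auto
  show "span ?S \<subseteq> tangent T"
    unfolding tangent_def by (rule span_mono) (use vertex_in_T in force)
qed

lemma affine_extension_linear:
  fixes w :: "nat \<Rightarrow> 'b::real_vector"
  obtains g where "linear g" "\<And>j. j \<le> n \<Longrightarrow> g (v j - v 0) = w j - w 0"
    "\<And>y. y \<in> T \<Longrightarrow> affine_extension n v w y = w 0 + g (y - v 0)"
proof -
  let ?e = "\<lambda>j. v j - v 0"
  let ?i = "inv_into {1..n} ?e"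
  obtain g where g: "linear g" "\<forall>x \<in> ?e ` {1..n}. g x = w (?i x) - w 0"
    using linear_independent_extend[OF edges_independent(2), of "\<lambda>x. w (?i x) - w 0"] by blast
  have gj: "g (?e j) = w j - w 0" if "j \<le> n" for j
    using that g inv_into_f_f[OF edges_independent(1), of j]
    by (cases "j = 0") (auto simp: linear_0)
  let ?f = "affine_extension n v w"
  have f: "affine_on T ?f \<and> (\<forall>j\<in>{0..n}. ?f (v j) = w j) \<and> (\<forall>x. x \<notin> T \<longrightarrow> ?f x = 0)"
    unfolding affine_extension_def by (rule theI'[OF ex1_affine_extension[OF simplex_vertices]])
  have aff: "affine_on T (\<lambda>y. w 0 + g (y - v 0))"
    using g(1) by (auto simp: affine_on_def linear_add linear_scale linear_diff algebra_simps)
  have fy: "?f y = w 0 + g (y - v 0)" if "y \<in> T" for y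
    using f gj by (intro affine_on_simplex_unique[OF _ aff _ that]) simp_all
  show ?thesis
  proof (rule that[of g])
    show "linear g" by (rule g(1))
    show "g (v j - v 0) = w j - w 0" if "j \<le> n" for j by (rule gj[OF that])
    show "?f y = w 0 + g (y - v 0)" if "y \<in> T" for y by (rule fy[OF that])
  qed
qed

lemma frechet_derivative_affine_extension:
  fixes w :: "nat \<Rightarrow> 'b::real_normed_vector"
  obtains g where "linear g" "\<And>j. j \<le> n \<Longrightarrow> g (v j - v 0) = w j - w 0"
    "\<And>y. y \<in> T \<Longrightarrow> affine_extension n v w y = w 0 + g (y - v 0)"
    "\<And>x u. x \<in> T \<Longrightarrow> u \<in> tangent T \<Longrightarrow>
       frechet_derivative (affine_extension n v w) (at x within T) u = g u"
proof -
  obtain g where g: "linear g" "\<And>j. j \<le> n \<Longrightarrow> g (v j - v 0) = w j - w 0"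
    "\<And>y. y \<in> T \<Longrightarrow> affine_extension n v w y = w 0 + g (y - v 0)"
    using affine_extension_linear by blast
  have fd: "frechet_derivative (affine_extension n v w) (at x within T) u = g u"
    if "x \<in> T" "u \<in> tangent T" for x u
  proof (rule frechet_derivative_tangent)
    have "((\<lambda>y. y - v 0) has_derivative (\<lambda>h. h)) (at x within T)"
      by (auto intro!: derivative_eq_intros)
    then have "((\<lambda>y. g (y - v 0)) has_derivative g) (at x within T)"
      by (rule bounded_linear.has_derivative[OF linear_conv_bounded_linear[THEN iffD1, OF g(1)]])
    then have "((\<lambda>y. w 0 + g (y - v 0)) has_derivative g) (at x within T)"
      by (auto intro!: derivative_eq_intros)
    then show "(affine_extension n v w has_derivative g) (at x within T)"
      using that(1) by (rule has_derivative_transform[rotated 2]) (simp_all add: g(3))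
  qed (use that in auto)
  show ?thesis
  proof (rule that[of g])
    show "linear g" by (rule g(1))
    show "g (v j - v 0) = w j - w 0" if "j \<le> n" for j by (rule g(2)[OF that])
    show "affine_extension n v w y = w 0 + g (y - v 0)" if "y \<in> T" for y by (rule g(3)[OF that])
    show "frechet_derivative (affine_extension n v w) (at x within T) u = g u"
      if "x \<in> T" "u \<in> tangent T" for x u by (rule fd[OF that])
  qed
qed

text \<open>One linear functional representing \<open>d\<lambda>_i\<close> at every point.
  \<open>ext_deriv\<close> is an arbitrary choice off the tangent space and may depend on the point
  there, which makes it unsuited to calculation.\<close>

definition bary_diff :: "nat \<Rightarrow> 'a \<Rightarrow> real" where
  "bary_diff i = (SOME g. linear g \<and>
     (\<forall>j\<le>n. g (v j - v 0) = (if i = j then 1 else 0) - (if i = 0 then 1 else 0)) \<and>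
     (\<forall>x\<in>T. \<forall>u\<in>tangent T. ext_deriv T (barycentric n v i) x u = g u))"

lemma bary_diff:
  shows linear_bary_diff: "linear (bary_diff i)"
    and bary_diff_vertex:
      "j \<le> n \<Longrightarrow> bary_diff i (v j - v 0) = (if i = j then 1 else 0) - (if i = 0 then 1 else 0)"
    and ext_deriv_barycentric:
      "x \<in> T \<Longrightarrow> u \<in> tangent T \<Longrightarrow> ext_deriv T (barycentric n v i) x u = bary_diff i u"
proof -
  obtain g where "linear g"
    "\<And>j. j \<le> n \<Longrightarrow> g (v j - v 0) = (if i = j then 1 else 0) - (if i = 0 then 1 else (0::real))"
    "\<And>x u. x \<in> T \<Longrightarrow> u \<in> tangent T \<Longrightarrow>
       frechet_derivative (affine_extension n v (\<lambda>j. if i = j then 1 else 0)) (at x within T) u = g u"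
    using frechet_derivative_affine_extension[of "\<lambda>j. if i = j then 1 else (0::real)"] by metis
  then have "\<exists>g. linear g \<and>
     (\<forall>j\<le>n. g (v j - v 0) = (if i = j then 1 else 0) - (if i = 0 then 1 else 0)) \<and>
     (\<forall>x\<in>T. \<forall>u\<in>tangent T. ext_deriv T (barycentric n v i) x u = g u)"
    unfolding ext_deriv_def barycentric_def by blast
  from someI_ex[OF this, folded bary_diff_def]
  show "linear (bary_diff i)"
    "j \<le> n \<Longrightarrow> bary_diff i (v j - v 0) = (if i = j then 1 else 0) - (if i = 0 then 1 else 0)"
    "x \<in> T \<Longrightarrow> u \<in> tangent T \<Longrightarrow> ext_deriv T (barycentric n v i) x u = bary_diff i u"
    by blast+
qed

lemma tangent_linear_eqI:
  fixes f g :: "'a \<Rightarrow> 'b::real_vector"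
  assumes "linear f" "linear g" "\<And>j. j \<le> n \<Longrightarrow> f (v j - v 0) = g (v j - v 0)" "u \<in> tangent T"
  shows "f u = g u"
proof (rule linear_eq_on_span[OF assms(1,2)])
  show "u \<in> span ((\<lambda>j. v j - v 0) ` {1..n})"
    using assms(4) by (simp only: tangent_eq)
  show "f b = g b" if "b \<in> (\<lambda>j. v j - v 0) ` {1..n}" for b
    using that assms(3) by (auto simp only: image_iff atLeastAtMost_iff)
qed

text \<open>The barycentric coordinates sum to 1, so their differentials sum to 0.\<close>

lemma sum_bary_diff:
  assumes "u \<in> tangent T"
  shows "(\<Sum>i\<le>n. bary_diff i u) = 0"
proof (rule tangent_linear_eqI[where g = "\<lambda>_. 0" and f = "\<lambda>u. \<Sum>i\<le>n. bary_diff i u"])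
  show "linear (\<lambda>u. \<Sum>i\<le>n. bary_diff i u)"
    by (intro linear_compose_sum ballI linear_bary_diff)
  show "(\<Sum>i\<le>n. bary_diff i (v j - v 0)) = 0" if "j \<le> n" for j
    using that by (simp add: bary_diff_vertex sum_subtractf sum.delta)
  show "linear (\<lambda>_. 0 :: real)"
    by (simp add: linear_iff)
qed (fact assms)

section \<open>Wedge products of barycentric differentials\<close>

definition simplex_form :: "nat list \<Rightarrow> 'a cform" where
  "simplex_form is = wedge T (map (\<lambda>i. ext_deriv T (barycentric n v i)) is)"

lemma simplex_form_eq:
  "simplex_form is x ws =
     (if x \<in> T \<and> set ws \<subseteq> tangent T \<and> length ws = length is
      then \<Sum>p | p permutes {..<length is}.
             of_int (sign p) * (\<Prod>i<length is. of_real (bary_diff (is ! i) (ws ! p i)))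
      else 0)"
proof (cases "x \<in> T \<and> set ws \<subseteq> tangent T \<and> length ws = length is")
  case True
  have "ext_deriv T (barycentric n v (is ! i)) x (ws ! p i) = bary_diff (is ! i) (ws ! p i)"
    if "p permutes {..<length is}" "i < length is" for p i
  proof -
    have "p i < length is" using permutes_in_image[OF that(1), of i] that(2) by simp
    then show ?thesis using True
      by (intro ext_deriv_barycentric) (auto dest: nth_mem)
  qed
  then have "(\<Sum>p | p permutes {..<length is}. of_int (sign p) *
      (\<Prod>i<length is. of_real (ext_deriv T (barycentric n v (is ! i)) x (ws ! p i))))
    = (\<Sum>p | p permutes {..<length is}. of_int (sign p) *
      (\<Prod>i<length is. complex_of_real (bary_diff (is ! i) (ws ! p i))))"
    by (intro sum.cong prod.cong arg_cong2[where f = "(*)"] refl) auto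
  with True show ?thesis
    by (simp add: simplex_form_def wedge_def)
qed (auto simp: simplex_form_def wedge_def)

text \<open>Reindexing the sum in the determinant by composition with \<sigma> turns the permutation
  of the factors into the factor \<open>sign \<sigma>\<close>.\<close>

lemma simplex_form_permute_list:
  assumes \<sigma>: "\<sigma> permutes {..<length is}"
  shows "simplex_form (permute_list \<sigma> is) = form_scale (of_int (sign \<sigma>)) (simplex_form is)"
proof -
  let ?K = "{..<length is}"
  have "(\<Sum>p | p permutes ?K. of_int (sign p) *
          (\<Prod>i<length is. of_real (bary_diff (permute_list \<sigma> is ! i) (ws ! p i))))
      = (\<Sum>p | p permutes ?K. of_int (sign \<sigma>) * (of_int (sign p) *
          (\<Prod>i<length is. complex_of_real (bary_diff (is ! i) (ws ! p i)))))"
    (is "sum ?f _ = sum ?g _") for ws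
  proof -
    have "sum ?f {p. p permutes ?K} = (\<Sum>p | p permutes ?K. ?f (p \<circ> \<sigma>))"
      by (rule sum_permutations_compose_right[OF \<sigma>])
    also have "\<dots> = sum ?g {p. p permutes ?K}"
    proof (rule sum.cong)
      fix p assume "p \<in> {p. p permutes ?K}"
      then have p: "p permutes ?K" by simp
      have "sign (p \<circ> \<sigma>) = sign p * sign \<sigma>"
        using p \<sigma> by (intro sign_compose permutes_imp_permutation[of ?K]) auto
      moreover have "(\<Prod>i<length is. complex_of_real (bary_diff (permute_list \<sigma> is ! i) (ws ! (p \<circ> \<sigma>) i)))
        = (\<Prod>i<length is. of_real (bary_diff (is ! \<sigma> i) (ws ! p (\<sigma> i))))"
        by (rule prod.cong) (auto simp: permute_list_nth[OF \<sigma>])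
      moreover have "\<dots> = (\<Prod>i<length is. of_real (bary_diff (is ! i) (ws ! p i)))"
        using prod.permute[OF \<sigma>, of "\<lambda>i. complex_of_real (bary_diff (is ! i) (ws ! p i))"]
        by (simp add: o_def)
      ultimately show "?f (p \<circ> \<sigma>) = ?g p" by simp
    qed auto
    finally show ?thesis .
  qed
  then show ?thesis
    by (simp add: fun_eq_iff simplex_form_eq form_scale_def sum_distrib_left)
qed

lemma bary_diff_edge:
  assumes "a \<le> n" "b \<le> n"
  shows "bary_diff i (v a - v b) = (if i = a then 1 else 0) - (if i = b then 1 else 0)"
proof -
  have "bary_diff i (v a - v b) = bary_diff i ((v a - v 0) - (v b - v 0))" by simp
  also have "\<dots> = bary_diff i (v a - v 0) - bary_diff i (v b - v 0)"
    by (rule linear_diff[OF linear_bary_diff])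
  finally show ?thesis using assms by (simp only: bary_diff_vertex)
qed

lemma simplex_form_transpose:
  assumes "i < length is" "j < length is" "i \<noteq> j"
  shows "simplex_form (permute_list (transp i j) is) = form_scale (- 1) (simplex_form is)"
  using simplex_form_permute_list[of "transp i j" "is"] assms
  by (simp add: permutes_swap_id sign_swap_id)

lemma simplex_form_not_distinct:
  assumes "\<not> distinct is"
  shows "simplex_form is = 0"
proof -
  obtain i j where ij: "i < length is" "j < length is" "i \<noteq> j" "is ! i = is ! j"
    using assms by (auto simp: distinct_conv_nth)
  have "transp i j permutes {..<length is}"
    using ij by (intro permutes_swap_id) auto
  then have "permute_list (transp i j) is = is"
    using ij by (intro nth_equalityI) (auto simp: permute_list_nth Transposition.transpose_def)
  then have "simplex_form is = form_scale (- 1) (simplex_form is)"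
    using simplex_form_transpose[OF ij(1-3)] by simp
  then have "simplex_form is x ws = - simplex_form is x ws" for x ws
    by (metis form_scale_def mult_minus1)
  then show ?thesis by (simp add: fun_eq_iff zero_fun_apply)
qed

lemma simplex_form_map_permutes:
  assumes "distinct is" "\<sigma> permutes set is"
  shows "simplex_form (map \<sigma> is) = form_scale (of_int (sign \<sigma>)) (simplex_form is)"
  using assms(2) finite_set[of "is"]
proof (induction \<sigma> rule: permutes_induct)
  case id
  then show ?case by (simp add: form_scale_def)
next
  case (swap a b p)
  let ?L = "map p is"
  have L: "distinct ?L" "set ?L = set is"
    using assms(1) swap(4) by (auto simp: distinct_map permutes_inj_on permutes_image)
  obtain i j where ij: "i < length ?L" "j < length ?L" "a = ?L ! i" "b = ?L ! j"
    using swap(1,2) L(2) by (metis in_set_conv_nth)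
  have "simplex_form (map (transp a b \<circ> p) is) = simplex_form (map (transp a b) ?L)"
    by simp
  also have "\<dots> = simplex_form (permute_list (transp i j) ?L)"
    using map_transpose_eq_permute_list[OF L(1) ij(1,2)] ij(3,4) by simp
  also have "\<dots> = form_scale (- 1) (simplex_form ?L)"
    using ij swap(3) by (intro simplex_form_transpose) auto
  also have "\<dots> = form_scale (- of_int (sign p)) (simplex_form is)"
    using swap.IH by (simp add: form_scale_def)
  also have "- of_int (sign p) = (of_int (sign (transp a b \<circ> p)) :: complex)"
    using swap(3,4) permutes_imp_permutation[OF finite_set swap(4)]
    by (simp add: sign_compose permutation_swap_id sign_swap_id del: o_apply)
  finally show ?case .
qed

lemma simplex_form_mset_eq:
  assumes "mset is = mset js"
  obtains c where "c = 1 \<or> c = - 1" "simplex_form is = form_scale c (simplex_form js)"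
proof -
  obtain p where p: "p permutes {..<length js}" "permute_list p js = is"
    using mset_eq_permutation[OF assms] by blast
  then have "simplex_form is = form_scale (of_int (sign p)) (simplex_form js)"
    using simplex_form_permute_list[OF p(1)] by simp
  then show ?thesis using that[of "of_int (sign p)"] by (auto simp: sign_def split: if_splits)
qed

text \<open>The relation that the \<open>d\<lambda>_l\<close> sum to 0, inserted into slot
  \<open>p\<close>: every summand of the determinant has exactly one factor from that slot. It
  serves to eliminate the index 0.\<close>

lemma sum_simplex_form:
  assumes p: "p < length is"
  shows "(\<Sum>l\<le>n. simplex_form (is[p := l])) = 0"
proof -
  let ?K = "{..<length is}"
  have "(\<Sum>l\<le>n. \<Sum>\<sigma> | \<sigma> permutes ?K. of_int (sign \<sigma>) *
     (\<Prod>i\<in>?K. complex_of_real (bary_diff (is[p := l] ! i) (ws ! \<sigma> i)))) = 0"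
    if ws: "set ws \<subseteq> tangent T" "length ws = length is" for ws
  proof -
    have "(\<Sum>l\<le>n. of_int (sign \<sigma>) *
     (\<Prod>i\<in>?K. complex_of_real (bary_diff (is[p := l] ! i) (ws ! \<sigma> i)))) = 0"
      if \<sigma>: "\<sigma> permutes ?K" for \<sigma>
    proof -
      have "\<sigma> p < length ws"
        using permutes_in_image[OF \<sigma>, of p] p ws(2) by simp
      then have t: "ws ! \<sigma> p \<in> tangent T" using ws(1) by (auto dest: nth_mem)
      have "(\<Prod>i\<in>?K. complex_of_real (bary_diff (is[p := l] ! i) (ws ! \<sigma> i)))
        = of_real (bary_diff l (ws ! \<sigma> p)) *
          (\<Prod>i\<in>?K - {p}. complex_of_real (bary_diff (is ! i) (ws ! \<sigma> i)))" for l
      proof -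
        have "(\<Prod>i\<in>?K. complex_of_real (bary_diff (is[p := l] ! i) (ws ! \<sigma> i)))
          = of_real (bary_diff (is[p := l] ! p) (ws ! \<sigma> p)) *
            (\<Prod>i\<in>?K - {p}. complex_of_real (bary_diff (is[p := l] ! i) (ws ! \<sigma> i)))"
          using p by (intro prod.remove) auto
        then show ?thesis using p by simp
      qed
      then have "(\<Sum>l\<le>n. of_int (sign \<sigma>) *
         (\<Prod>i\<in>?K. complex_of_real (bary_diff (is[p := l] ! i) (ws ! \<sigma> i))))
        = of_int (sign \<sigma>) * (of_real (\<Sum>l\<le>n. bary_diff l (ws ! \<sigma> p)) *
          (\<Prod>i\<in>?K - {p}. complex_of_real (bary_diff (is ! i) (ws ! \<sigma> i))))"
        by (simp add: sum_distrib_left sum_distrib_right)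
      then show ?thesis by (simp add: sum_bary_diff[OF t])
    qed
    then show ?thesis by (subst sum.swap) (simp add: sum.neutral)
  qed
  note * = this
  show ?thesis
  proof (intro ext)
    fix x ws
    show "(\<Sum>l\<le>n. simplex_form (is[p := l])) x ws = 0 x ws"
    proof (cases "x \<in> T \<and> set ws \<subseteq> tangent T \<and> length ws = length is")
      case True
      then show ?thesis
        using *[of ws] by (simp add: sum_form_apply simplex_form_eq zero_fun_apply)
    next
      case False
      then have "simplex_form (is[p := l]) x ws = 0" for l
        by (auto simp: simplex_form_eq)
      then show ?thesis by (simp add: sum_form_apply zero_fun_apply)
    qed
  qed
qed

text \<open>The index 0 is left out because \<open>d\<lambda>_0\<close> is minus the sum of the
  other differentials; the remaining k-subsets index a basis of the constant forms.\<close>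

definition index_sets :: "nat \<Rightarrow> nat set set" where
  "index_sets k = {J. J \<subseteq> {1..n} \<and> card J = k}"

lemma finite_index_sets [simp]: "finite (index_sets k)"
  unfolding index_sets_def by (rule finite_subset[of _ "Pow {1..n}"]) auto

lemma index_setsD:
  assumes "J \<in> index_sets k"
  shows "J \<subseteq> {1..n}" "card J = k" "finite J" "set (sorted_list_of_set J) = J"
    "length (sorted_list_of_set J) = k"
proof -
  show J: "J \<subseteq> {1..n}" "card J = k" using assms by (auto simp: index_sets_def)
  then show "finite J" using finite_subset by blast
  then show "set (sorted_list_of_set J) = J" "length (sorted_list_of_set J) = k"
    using J by auto
qed

definition basic_form :: "nat set \<Rightarrow> 'a cform" where
  "basic_form J = simplex_form (sorted_list_of_set J)"

text \<open>The functionals dual to the basic forms: evaluation on the edges at the vertex \<open>v 0\<close>.\<close>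

definition coef :: "nat set \<Rightarrow> 'a cform \<Rightarrow> complex" where
  "coef J \<omega> = \<omega> (v 0) (map (\<lambda>j. v j - v 0) (sorted_list_of_set J))"

lemma coef_linear [simp]:
  "coef J (\<omega> + \<omega>') = coef J \<omega> + coef J \<omega>'" "coef J (form_scale c \<omega>) = c * coef J \<omega>"
  "coef J 0 = 0" "coef J (- \<omega>) = - coef J \<omega>" "coef J (\<omega> - \<omega>') = coef J \<omega> - coef J \<omega>'"
  "coef J (\<Sum>i\<in>A. f i) = (\<Sum>i\<in>A. coef J (f i))"
  by (simp_all add: coef_def form_scale_def sum_form_apply plus_fun_apply zero_fun_apply)

lemma coef_simplex_form:
  assumes J: "J \<in> index_sets k" and "is": "set is \<subseteq> {1..n}" "length is = k"
  shows "coef J (simplex_form is) = (\<Sum>p | p permutes {..<k}. of_int (sign p) *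
    (\<Prod>i<k. if is ! i = sorted_list_of_set J ! p i then 1 else 0))"
proof -
  let ?L = "sorted_list_of_set J"
  have tang: "set (map (\<lambda>j. v j - v 0) ?L) \<subseteq> tangent T"
    using index_setsD[OF J] by auto
  have "(\<Prod>i<k. complex_of_real (bary_diff (is ! i) (map (\<lambda>j. v j - v 0) ?L ! p i)))
     = (\<Prod>i<k. if is ! i = ?L ! p i then 1 else 0)" if p: "p permutes {..<k}" for p
  proof (rule prod.cong)
    fix i assume "i \<in> {..<k}"
    then have i: "i < k" "p i < k" using permutes_in_image[OF p, of i] by auto
    then have "is ! i \<in> {1..n}" "?L ! p i \<in> J"
      using "is" index_setsD[OF J] nth_mem by (fastforce, metis nth_mem)
    then show "complex_of_real (bary_diff (is ! i) (map (\<lambda>j. v j - v 0) ?L ! p i))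
      = (if is ! i = ?L ! p i then 1 else 0)"
      using i index_setsD[OF J] by (auto simp: bary_diff_vertex)
  qed simp
  then show ?thesis
    using tang "is"(2) index_setsD(5)[OF J]
    by (simp add: coef_def simplex_form_eq)
qed

text \<open>A nonzero summand of the determinant would match the entries of \<open>is\<close> with
  the elements of \<open>J\<close>. The index 0 is excluded since \<open>bary_diff 0\<close> is -1
  on every edge v j - v 0 with 1 \<le> j \<le> n instead of a Kronecker delta.\<close>

lemma coef_simplex_form_other:
  assumes J: "J \<in> index_sets k" and "is": "set is \<subseteq> {1..n}" "length is = k" and ne: "set is \<noteq> J"
  shows "coef J (simplex_form is) = 0"
proof -
  let ?L = "sorted_list_of_set J"
  have "(\<Prod>i<k. if is ! i = ?L ! p i then 1 else (0::complex)) = 0" if p: "p permutes {..<k}" for p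
  proof (rule ccontr)
    assume "(\<Prod>i<k. if is ! i = ?L ! p i then 1 else (0::complex)) \<noteq> 0"
    then have eq: "is ! i = ?L ! p i" if "i < k" for i
      using that by (auto simp: prod_zero_iff split: if_splits)
    have "set is = (\<lambda>i. is ! i) ` {..<k}"
      using "is"(2) by (auto simp: set_conv_nth)
    also have "\<dots> = (\<lambda>i. ?L ! i) ` p ` {..<k}"
      unfolding image_image using eq by (intro image_cong) auto
    also have "\<dots> = J"
      using index_setsD(4,5)[OF J] by (auto simp: permutes_image[OF p] set_conv_nth)
    finally show False using ne by simp
  qed
  then show ?thesis
    unfolding coef_simplex_form[OF J "is"] by (intro sum.neutral ballI) simp
qed

lemma coef_basic_form:
  assumes J: "J \<in> index_sets k" and J': "J' \<in> index_sets k"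
  shows "coef J (basic_form J') = (if J = J' then 1 else 0)"
proof (cases "J = J'")
  case False
  then show ?thesis
    using coef_simplex_form_other[OF J, of "sorted_list_of_set J'"] index_setsD[OF J']
    by (simp add: basic_form_def)
next
  case True
  let ?L = "sorted_list_of_set J"
  have "(\<Prod>i<k. if ?L ! i = ?L ! p i then 1 else (0::complex)) = (if p = id then 1 else 0)"
    if p: "p permutes {..<k}" for p
  proof (cases "p = id")
    case False
    then obtain i where i: "p i \<noteq> i" by (auto simp: fun_eq_iff)
    then have "i < k" "p i < k"
      using p permutes_in_image[OF p, of i] permutes_not_in[OF p, of i] by auto
    then have "?L ! i \<noteq> ?L ! p i"
      using i index_setsD(5)[OF J] by (simp add: nth_eq_iff_index_eq)
    then show ?thesis using \<open>i < k\<close> False by (auto intro!: prod_zero)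
  qed simp
  then have "coef J (simplex_form ?L) =
      (\<Sum>p | p permutes {..<k}. of_int (sign p) * (if p = id then 1 else 0))"
    using index_setsD[OF J] coef_simplex_form[OF J, of ?L] by simp
  also have "\<dots> = 1"
    by (simp add: if_distrib[of "\<lambda>a. _ * a"] sum.delta finite_permutations permutes_id cong: if_cong)
  finally show ?thesis using True by (simp add: basic_form_def)
qed

section \<open>The action of permutations on constant forms\<close>

definition act :: "(nat \<Rightarrow> nat) \<Rightarrow> 'a cform \<Rightarrow> 'a cform" where
  "act \<pi> = pullback T (simplex_aut n v \<pi>)"

lemma act_linear [simp]:
  "act \<pi> (\<omega> + \<omega>') = act \<pi> \<omega> + act \<pi> \<omega>'" "act \<pi> (form_scale c \<omega>) = form_scale c (act \<pi> \<omega>)"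
  "act \<pi> 0 = 0" "act \<pi> (\<omega> - \<omega>') = act \<pi> \<omega> - act \<pi> \<omega>'"
  by (auto simp: act_def pullback_def form_scale_def fun_eq_iff plus_fun_apply zero_fun_apply)

lemma act_sum [simp]: "act \<pi> (\<Sum>i\<in>A. f i) = (\<Sum>i\<in>A. act \<pi> (f i))"
  by (induction A rule: infinite_finite_induct) auto

text \<open>As the automorphism sends v_i to the vertex with index \<open>inv \<pi> i\<close>,
  pulling \<lambda>_i back gives the coordinate with index \<open>\<pi> i\<close>. The inverse in
  the definition thus makes indices move by \<pi> itself, and \<open>act\<close> is a left action on
  constant forms.\<close>

lemma act_simplex_form:
  assumes \<pi>: "\<pi> permutes {0..n}" and "is": "set is \<subseteq> {0..n}"
  shows "act \<pi> (simplex_form is) = simplex_form (map \<pi> is)"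
proof -
  have inv_le: "inv \<pi> j \<le> n" if "j \<le> n" for j
    using permutes_in_image[OF permutes_inv[OF \<pi>], of j] that by simp
  obtain g where g: "linear g" "\<And>j. j \<le> n \<Longrightarrow> g (v j - v 0) = v (inv \<pi> j) - v (inv \<pi> 0)"
    "\<And>y. y \<in> T \<Longrightarrow> simplex_aut n v \<pi> y = v (inv \<pi> 0) + g (y - v 0)"
    "\<And>x u. x \<in> T \<Longrightarrow> u \<in> tangent T \<Longrightarrow>
       frechet_derivative (simplex_aut n v \<pi>) (at x within T) u = g u"
    using frechet_derivative_affine_extension[of "\<lambda>j. v (inv \<pi> j)"] unfolding simplex_aut_def
    by metis
  have aut_T: "simplex_aut n v \<pi> x \<in> T" if "x \<in> T" for x
    using that
  proof (induction rule: T_affine_induct)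
    case (vertex j)
    then show ?case using g(2,3) inv_le by simp
  next
    case (convex x y u)
    have "g ((1 - u) *\<^sub>R x + u *\<^sub>R y - v 0) = (1 - u) *\<^sub>R g (x - v 0) + u *\<^sub>R g (y - v 0)"
      using g(1) by (simp add: linear_add linear_diff linear_scale algebra_simps)
    moreover have "(1 - u) *\<^sub>R x + u *\<^sub>R y \<in> T"
      using convex convex_T by (simp add: convex_alt)
    ultimately have "simplex_aut n v \<pi> ((1 - u) *\<^sub>R x + u *\<^sub>R y)
        = (1 - u) *\<^sub>R simplex_aut n v \<pi> x + u *\<^sub>R simplex_aut n v \<pi> y"
      using convex(1,2) g(3) by (simp add: algebra_simps)
    then show ?case using convex convex_T by (simp add: convex_alt)
  qed
  have g_tangent: "g u \<in> tangent T" if "u \<in> tangent T" for u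
  proof -
    have "g ` span ((\<lambda>j. v j - v 0) ` {1..n}) \<subseteq> tangent T"
      unfolding linear_span_image[OF g(1), symmetric]
    proof (rule span_minimal)
      show "g ` (\<lambda>j. v j - v 0) ` {1..n} \<subseteq> tangent T"
        using inv_le by (auto simp: g(2))
      show "subspace (tangent T)" unfolding tangent_def by simp
    qed
    then show ?thesis using that by (auto simp: tangent_eq)
  qed
  have bary: "bary_diff i (g u) = bary_diff (\<pi> i) u" if "u \<in> tangent T" "i \<le> n" for i u
  proof (rule tangent_linear_eqI[OF _ _ _ that(1), of "\<lambda>u. bary_diff i (g u)"])
    show "linear (\<lambda>u. bary_diff i (g u))"
      using linear_compose[OF g(1) linear_bary_diff[of i]] by (simp add: o_def)
    show "bary_diff i (g (v j - v 0)) = bary_diff (\<pi> i) (v j - v 0)" if j: "j \<le> n" for j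
    proof -
      have "i = inv \<pi> l \<longleftrightarrow> \<pi> i = l" for l
        using permutes_inverses[OF \<pi>] by metis
      then show ?thesis
        using j inv_le[OF j] inv_le[of 0]
        by (simp only: g(2)[OF j] bary_diff_edge bary_diff_vertex)
    qed
  qed (rule linear_bary_diff)
  show ?thesis
  proof (intro ext)
    fix x ws
    show "act \<pi> (simplex_form is) x ws = simplex_form (map \<pi> is) x ws"
    proof (cases "x \<in> T \<and> set ws \<subseteq> tangent T \<and> length ws = length is")
      case True
      have ws': "map (frechet_derivative (simplex_aut n v \<pi>) (at x within T)) ws = map g ws"
        using True g(4) by (intro map_cong) auto
      have "bary_diff (is ! i) (map g ws ! p i) = bary_diff (map \<pi> is ! i) (ws ! p i)"
        if p: "p permutes {..<length is}" and i: "i < length is" for p i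
      proof -
        have pi: "p i < length ws" using permutes_in_image[OF p, of i] i True by simp
        have "ws ! p i \<in> tangent T" "is ! i \<le> n"
          using True pi "is" i by (auto dest: nth_mem)
        then show ?thesis using bary pi i by simp
      qed
      then have "(\<Sum>p | p permutes {..<length is}. of_int (sign p) *
            (\<Prod>i<length is. complex_of_real (bary_diff (is ! i) (map g ws ! p i))))
          = (\<Sum>p | p permutes {..<length is}. of_int (sign p) *
            (\<Prod>i<length is. complex_of_real (bary_diff (map \<pi> is ! i) (ws ! p i))))"
        by (intro sum.cong prod.cong arg_cong2[where f = "(*)"] refl) auto
      moreover have "set (map g ws) \<subseteq> tangent T"
        using True g_tangent by auto
      ultimately show ?thesis
        using True aut_T by (simp add: act_def pullback_def ws' simplex_form_eq)
    qed (auto simp: act_def pullback_def simplex_form_eq)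
  qed
qed

lemma constant_forms_eq:
  "constant_forms n v k = cform.span {simplex_form is | is. length is = k \<and> set is \<subseteq> {0..n}}"
  by (simp add: constant_forms_def simplex_form_def)

lemma simplex_form_in_constant_forms:
  "length is = k \<Longrightarrow> set is \<subseteq> {0..n} \<Longrightarrow> simplex_form is \<in> constant_forms n v k"
  unfolding constant_forms_eq by (rule cform.span_base) auto

lemma basic_form_in_constant_forms:
  "J \<in> index_sets k \<Longrightarrow> basic_form J \<in> constant_forms n v k"
  unfolding basic_form_def using index_setsD[of J k]
  by (intro simplex_form_in_constant_forms) auto

lemma constant_forms_induct [consumes 1, case_names zero add]:
  assumes "\<omega> \<in> constant_forms n v k" "P 0"
    and "\<And>c is \<omega>. length is = k \<Longrightarrow> set is \<subseteq> {0..n} \<Longrightarrow> P \<omega> \<Longrightarrow> P (form_scale c (simplex_form is) + \<omega>)"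
  shows "P \<omega>"
  using assms(1) unfolding constant_forms_eq
  by (rule cform.span_induct_alt) (use assms(2,3) in auto)

text \<open>Repeated indices give 0, distinct indices in \<open>{1..n}\<close> are sorted up to
  sign, and an index 0 is traded for minus the sum over the others. The coefficients are values of
  \<open>coef\<close> because these functionals are linear and dual to the basic forms.\<close>

lemma simplex_form_expand:
  assumes "length is = k" "set is \<subseteq> {0..n}"
  shows "simplex_form is = (\<Sum>J\<in>index_sets k. form_scale (coef J (simplex_form is)) (basic_form J))"
    (is "?P is")
proof -
  have base: "?P is" if "is": "length is = k" "set is \<subseteq> {1..n}" "distinct is" for "is"
  proof -
    have J: "set is \<in> index_sets k"
      using that distinct_card[OF "is"(3)] by (auto simp: index_sets_def)
    have "mset is = mset (sorted_list_of_set (set is))"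
      using "is"(3) by (metis distinct_sorted_list_of_set finite_set set_eq_iff_mset_eq_distinct
          set_sorted_list_of_set)
    then obtain c where c: "simplex_form is = form_scale c (basic_form (set is))"
      unfolding basic_form_def by (rule simplex_form_mset_eq)
    have "(\<Sum>J\<in>index_sets k. form_scale (coef J (simplex_form is)) (basic_form J))
        = (\<Sum>J\<in>index_sets k. if J = set is then simplex_form is else 0)"
    proof (rule sum.cong)
      fix J' assume J': "J' \<in> index_sets k"
      show "form_scale (coef J' (simplex_form is)) (basic_form J')
        = (if J' = set is then simplex_form is else 0)"
        using coef_basic_form[OF J' J] unfolding c by (auto simp del: cform.scale_eq_0_iff)
    qed simp
    then show ?thesis using J by simp
  qed
  consider "\<not> distinct is" | "distinct is" "0 \<notin> set is" | "distinct is" "0 \<in> set is" by blast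
  then show ?thesis
  proof cases
    case 1
    then show ?thesis by (simp add: simplex_form_not_distinct)
  next
    case 2
    have "set is \<subseteq> {1..n}"
    proof
      fix i assume "i \<in> set is"
      then show "i \<in> {1..n}" using assms(2) 2(2) by (cases "i = 0") auto
    qed
    then show ?thesis using 2 assms by (intro base)
  next
    case 3
    then obtain p where p: "p < length is" "is ! p = 0" by (metis in_set_conv_nth)
    have "{..n} = insert 0 {1..n}" by auto
    then have "simplex_form (is[p := 0]) + (\<Sum>l\<in>{1..n}. simplex_form (is[p := l])) = 0"
      using sum_simplex_form[OF p(1)] by simp
    moreover define S where "S = (\<Sum>l\<in>{1..n}. simplex_form (is[p := l]))"
    ultimately have eq: "simplex_form is = - S"
      using p by (metis add_eq_0_iff2 list_update_id)
    have "?P (is[p := l])" if l: "l \<in> {1..n}" for l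
    proof (cases "distinct (is[p := l])")
      case True
      have "set (is[p := l]) \<subseteq> {1..n}"
      proof
        fix i assume "i \<in> set (is[p := l])"
        then obtain q where q: "q < length is" "i = is[p := l] ! q" by (auto simp: in_set_conv_nth)
        show "i \<in> {1..n}"
        proof (cases "q = p")
          case False
          then have "i = is ! q" "is ! q \<noteq> is ! p"
            using q nth_eq_iff_index_eq[OF 3(1) q(1) p(1)] by auto
          moreover have "is ! q \<in> {0..n}" using assms(2) q(1) by (auto dest: nth_mem)
          ultimately show ?thesis using p(2) by auto
        qed (use q l in auto)
      qed
      then show ?thesis using True assms(1) by (intro base) auto
    qed (simp add: simplex_form_not_distinct)
    then have "S = (\<Sum>l\<in>{1..n}. \<Sum>J\<in>index_sets k. form_scale (coef J (simplex_form (is[p := l]))) (basic_form J))"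
      unfolding S_def by (intro sum.cong refl)
    also have "\<dots> = (\<Sum>J\<in>index_sets k. form_scale (coef J S) (basic_form J))"
      unfolding S_def by (subst sum.swap) (simp add: cform.scale_sum_left)
    finally have "- S = - (\<Sum>J\<in>index_sets k. form_scale (coef J S) (basic_form J))"
      by (rule arg_cong)
    also have "\<dots> = (\<Sum>J\<in>index_sets k. form_scale (coef J (- S)) (basic_form J))"
      by (simp only: coef_linear cform.scale_minus_left sum_negf)
    finally show ?thesis unfolding eq .
  qed
qed

lemma constant_forms_expand:
  assumes "\<omega> \<in> constant_forms n v k"
  shows "\<omega> = (\<Sum>J\<in>index_sets k. form_scale (coef J \<omega>) (basic_form J))"
  using assms
proof (induction rule: constant_forms_induct)
  case zero
  then show ?case by simp
next
  case (add c "is" \<omega>)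
  have "(\<Sum>J\<in>index_sets k. form_scale (coef J (form_scale c (simplex_form is) + \<omega>)) (basic_form J)) =
      form_scale c (\<Sum>J\<in>index_sets k. form_scale (coef J (simplex_form is)) (basic_form J))
      + (\<Sum>J\<in>index_sets k. form_scale (coef J \<omega>) (basic_form J))"
    by (simp add: cform.scale_sum_right cform.scale_left_distrib sum.distrib)
  then show ?case
    using simplex_form_expand[OF add(1,2), symmetric] add(3)[symmetric] by (simp only:)
qed

lemma act_in_constant_forms:
  assumes "\<pi> permutes {0..n}" "\<omega> \<in> constant_forms n v k"
  shows "act \<pi> \<omega> \<in> constant_forms n v k"
  using assms(2)
proof (induction rule: constant_forms_induct)
  case zero
  then show ?case by (simp add: constant_forms_def cform.span_zero)
next
  case (add c "is" \<omega>)
  have "set (map \<pi> is) \<subseteq> {0..n}" "length (map \<pi> is) = k"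
    using add(1,2) permutes_image[OF assms(1)] by auto
  then have "simplex_form (map \<pi> is) \<in> constant_forms n v k"
    by (intro simplex_form_in_constant_forms)
  then show ?case using add
    by (simp add: act_simplex_form[OF assms(1)] constant_forms_def cform.span_add cform.span_scale)
qed

lemma act_comp:
  assumes "\<pi> permutes {0..n}" "\<sigma> permutes {0..n}" "\<omega> \<in> constant_forms n v k"
  shows "act \<pi> (act \<sigma> \<omega>) = act (\<pi> \<circ> \<sigma>) \<omega>"
  using assms(3)
proof (induction rule: constant_forms_induct)
  case (add c "is" \<omega>)
  have "set (map \<sigma> is) \<subseteq> {0..n}"
    using add(2) permutes_image[OF assms(2)] by auto
  then have "act \<pi> (act \<sigma> (simplex_form is)) = act (\<pi> \<circ> \<sigma>) (simplex_form is)"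
    unfolding act_simplex_form[OF assms(2) add(2)] act_simplex_form[OF permutes_compose[OF assms(2,1)] add(2)]
    by (simp add: act_simplex_form assms(1))
  then show ?case
    using add.IH by (simp only: act_linear)
qed simp

lemma act_id:
  assumes "\<omega> \<in> constant_forms n v k"
  shows "act id \<omega> = \<omega>"
  using assms
proof (induction rule: constant_forms_induct)
  case (add c "is" \<omega>)
  then show ?case
    by (simp only: act_linear act_simplex_form[OF permutes_id] list.map_id)
qed simp

lemma act_basic_form:
  assumes "\<pi> permutes {0..n}" "J \<in> index_sets k"
  shows "act \<pi> (basic_form J) = simplex_form (map \<pi> (sorted_list_of_set J))"
  unfolding basic_form_def using index_setsD[OF assms(2)]
  by (intro act_simplex_form[OF assms(1)]) auto

text \<open>A basic form over \<open>K\<close> without \<open>j\<close> is fixed, and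
  \<open>coef J\<close> vanishes on it since \<open>j\<close> lies in \<open>J\<close>. If
  \<open>K\<close> contains \<open>j\<close>, then \<open>d\<lambda>_j\<close> becomes
  \<open>d\<lambda>_0\<close>, minus the sum of the other differentials; only the term with index
  \<open>j\<close> can contribute to \<open>J\<close>, and it is minus the original form.\<close>

lemma coef_act_transpose_0:
  assumes j: "j \<in> J" and J: "J \<in> index_sets k" and u: "u \<in> constant_forms n v k"
  shows "coef J (act (transp 0 j) u) = - coef J u"
proof -
  let ?t = "transp 0 j"
  have j1: "j \<in> {1..n}" using j index_setsD(1)[OF J] by blast
  have t: "?t permutes {0..n}" using j1 by (intro permutes_swap_id) auto
  have basic: "coef J (act ?t (basic_form K)) = - coef J (basic_form K)" if K: "K \<in> index_sets k" for K
  proof -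
    note KD = index_setsD[OF K]
    let ?L = "sorted_list_of_set K"
    show ?thesis
    proof (cases "j \<in> K")
      case False
      have "map ?t ?L = ?L"
      proof (rule map_idI)
        fix x assume "x \<in> set ?L"
        then have "x \<noteq> 0" "x \<noteq> j" using KD False by auto
        then show "?t x = x" by simp
      qed
      then have "act ?t (basic_form K) = basic_form K"
        unfolding act_basic_form[OF t K] by (simp add: basic_form_def)
      moreover have "J \<noteq> K" using j False by blast
      ultimately show ?thesis using coef_basic_form[OF J K] by simp
    next
      case True
      then obtain p where p: "p < length ?L" "?L ! p = j" using KD(4) by (metis in_set_conv_nth)
      have nth_ne: "?L ! i \<noteq> j" if "i < length ?L" "i \<noteq> p" for i
        using nth_eq_iff_index_eq[OF _ that(1) p(1)] that(2) p(2) by auto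
      have L_in: "?L ! i \<in> {1..n}" if "i < length ?L" for i
        using KD(1,4) nth_mem[OF that] by blast
      have map_t: "map ?t ?L = ?L[p := 0]"
      proof (rule nth_equalityI)
        fix i assume "i < length (map ?t ?L)"
        then have i: "i < length ?L" by simp
        then show "map ?t ?L ! i = ?L[p := 0] ! i"
          using L_in[OF i] nth_ne[OF i] p by (cases "i = p") auto
      qed simp
      have upd_j: "?L[p := j] = ?L" using p(2) list_update_id[of ?L p] by simp
      have "coef J (simplex_form (?L[p := l])) = 0" if l: "l \<in> {1..n}" "l \<noteq> j" for l
      proof (rule coef_simplex_form_other[OF J])
        show "set (?L[p := l]) \<subseteq> {1..n}"
          using set_update_subset_insert[of ?L p l] KD(1,4) l by auto
        have "j \<notin> set (?L[p := l])"
        proof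
          assume "j \<in> set (?L[p := l])"
          then obtain i where "i < length ?L" "?L[p := l] ! i = j" by (auto simp: in_set_conv_nth)
          then show False using nth_ne[of i] l(2) by (cases "i = p") auto
        qed
        then show "set (?L[p := l]) \<noteq> J" using j by blast
      qed (simp add: KD)
      then have "(\<Sum>l\<in>{1..n}. coef J (simplex_form (?L[p := l])))
          = (\<Sum>l\<in>{1..n}. if l = j then coef J (basic_form K) else 0)"
        by (intro sum.cong refl) (auto simp: upd_j basic_form_def)
      also have "\<dots> = coef J (basic_form K)" using j1 by simp
      finally have S: "(\<Sum>l\<in>{1..n}. coef J (simplex_form (?L[p := l]))) = coef J (basic_form K)" .
      have "{..n} = insert 0 {1..n}" by auto
      then have "coef J (simplex_form (?L[p := 0])) + (\<Sum>l\<in>{1..n}. coef J (simplex_form (?L[p := l]))) = 0"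
        using arg_cong[OF sum_simplex_form[OF p(1)], of "coef J"] by simp
      then show ?thesis
        unfolding act_basic_form[OF t K] map_t S by (simp add: add_eq_0_iff2)
    qed
  qed
  have "coef J (act ?t u) = coef J (act ?t (\<Sum>K\<in>index_sets k. form_scale (coef K u) (basic_form K)))"
    using constant_forms_expand[OF u] by (rule arg_cong)
  also have "\<dots> = (\<Sum>K\<in>index_sets k. coef K u * coef J (act ?t (basic_form K)))"
    by (simp only: act_sum act_linear coef_linear)
  also have "\<dots> = - (\<Sum>K\<in>index_sets k. coef K u * coef J (basic_form K))"
    using basic by (simp add: sum_negf)
  also have "(\<Sum>K\<in>index_sets k. coef K u * coef J (basic_form K))
      = coef J (\<Sum>K\<in>index_sets k. form_scale (coef K u) (basic_form K))"
    by (simp only: coef_linear)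
  also have "\<dots> = coef J u"
    using constant_forms_expand[OF u, symmetric] by (rule arg_cong)
  finally show ?thesis .
qed

text \<open>Any other \<open>J\<close> of the same size has an element \<open>j\<close> outside
  \<open>I\<close>, and the transposition of 0 and \<open>j\<close> fixes \<open>u\<close> while
  negating its coefficient at \<open>J\<close>. The common invariants are thus a single line; this
  multiplicity one is the source of irreducibility.\<close>

lemma invariants_of_transpositions:
  assumes I: "I \<in> index_sets k" and u: "u \<in> constant_forms n v k"
    and inv: "\<And>j. j \<in> {1..n} \<Longrightarrow> j \<notin> I \<Longrightarrow> act (transp 0 j) u = u"
  shows "u = form_scale (coef I u) (basic_form I)"
proof -
  have "coef J u = 0" if J: "J \<in> index_sets k" "J \<noteq> I" for J
  proof -
    have "\<not> J \<subseteq> I" using J index_setsD[OF J(1)] index_setsD[OF I] card_subset_eq by metis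
    then obtain j where j: "j \<in> J" "j \<notin> I" by blast
    then have "coef J u = - coef J u"
      using coef_act_transpose_0[OF j(1) J(1) u] inv[of j] index_setsD(1)[OF J(1)] by auto
    then show ?thesis by simp
  qed
  then have "(\<Sum>J\<in>index_sets k. form_scale (coef J u) (basic_form J))
      = (\<Sum>J\<in>index_sets k. if J = I then form_scale (coef I u) (basic_form I) else 0)"
    by (intro sum.cong refl) auto
  also have "\<dots> = form_scale (coef I u) (basic_form I)" using I by simp
  finally show ?thesis using constant_forms_expand[OF u] by simp
qed

lemma basic_form_act_invariant:
  assumes I: "I \<in> index_sets k" and j: "j \<in> {1..n}" "j \<notin> I"
  shows "act (transp 0 j) (basic_form I) = basic_form I"
proof -
  have t: "transp 0 j permutes {0..n}" using j by (intro permutes_swap_id) auto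
  have "map (transp 0 j) (sorted_list_of_set I) = sorted_list_of_set I"
  proof (rule map_idI)
    fix x assume "x \<in> set (sorted_list_of_set I)"
    then have "x \<noteq> 0" "x \<noteq> j" using index_setsD[OF I] j by auto
    then show "transp 0 j x = x" by simp
  qed
  then show ?thesis unfolding act_basic_form[OF t I] by (simp add: basic_form_def)
qed

end

section \<open>Traces\<close>

text \<open>The two sides count the positive and the negative contributions to the trace of a
  transposition. For 2 k < n unimodality decides, after a reflection if 2 k = n - 1; for 2 k > n
  symmetry exchanges the two sides with those for n - k. The conditional guards against truncation
  of k - 2 at k = 1.\<close>

lemma binomial_shift2_ne:
  assumes "0 < k" "k < n" "n \<noteq> 2 * k" "4 \<le> n"
  shows "(n - 2) choose k \<noteq> (if 2 \<le> k then (n - 2) choose (k - 2) else 0)"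
proof -
  have less: "(if 2 \<le> j then (n - 2) choose (j - 2) else 0) < (n - 2) choose j"
    if j: "0 < j" "2 * j < n" for j
  proof (cases "2 \<le> j")
    case True
    show ?thesis
    proof (cases "2 * j \<le> n - 2")
      case True
      then show ?thesis using j \<open>2 \<le> j\<close> by (auto intro: binomial_strict_mono)
    next
      case False
      then have "n - 2 - j = j - 1" "j \<le> n - 2" using j \<open>2 \<le> j\<close> by auto
      then have "(n - 2) choose j = (n - 2) choose (j - 1)"
        using binomial_symmetric[of j "n - 2"] by simp
      moreover have "(n - 2) choose (j - 2) < (n - 2) choose (j - 1)"
        using j \<open>2 \<le> j\<close> by (intro binomial_strict_mono) auto
      ultimately show ?thesis using \<open>2 \<le> j\<close> by simp
    qed
  next
    case False
    then have "j = 1" using j by simp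
    then show ?thesis using assms(4) by simp
  qed
  show ?thesis
  proof (cases "2 * k < n")
    case True
    then show ?thesis using less[of k] assms by (metis less_irrefl)
  next
    case False
    let ?j = "n - k"
    have "(if 2 \<le> ?j then (n - 2) choose (?j - 2) else 0) < (n - 2) choose ?j"
      using False assms by (intro less) auto
    moreover have k2: "2 \<le> k" using False assms by simp
    moreover have "(n - 2) choose ?j = (n - 2) choose (k - 2)"
    proof -
      have "k - 2 \<le> n - 2" "n - 2 - (k - 2) = ?j" using k2 assms by auto
      then show ?thesis using binomial_symmetric[of "k - 2" "n - 2"] by simp
    qed
    moreover have "(if 2 \<le> ?j then (n - 2) choose (?j - 2) else 0) = (n - 2) choose k"
    proof (cases "2 \<le> ?j")
      case True
      then have "n - 2 - k = ?j - 2" "k \<le> n - 2" by auto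
      then show ?thesis using True binomial_symmetric[of k "n - 2"] by simp
    next
      case False
      then show ?thesis using assms by (simp add: binomial_eq_0)
    qed
    ultimately show ?thesis by simp
  qed
qed

text \<open>With n - 4 = 2 M + 1 the index k - 2 is one of the two central ones, M and M + 1. Its
  binomial coefficient is therefore at least the terms for \<open>k\<close> and for k - 4, and
  strictly larger than one of them.\<close>

lemma binomial_shift4_less:
  assumes "n + 1 = 2 * m" "3 \<le> m" "k = m \<or> k + 1 = m"
  shows "((n - 4) choose k) + (if 4 \<le> k then (n - 4) choose (k - 4) else 0)
    < 2 * ((n - 4) choose (k - 2))"
proof -
  define M where "M = m - 3"
  then have n: "n - 4 = 2 * M + 1" and m: "m = M + 3" using assms by auto
  have central: "(2 * M + 1) choose (M + 1) = (2 * M + 1) choose M"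
    using binomial_symmetric[of M "2 * M + 1"] by simp
  consider "k = M + 2" | "k = M + 3" using assms m by auto
  then show ?thesis
  proof cases
    case 1
    have "(2 * M + 1) choose (M + 2) < (2 * M + 1) choose M"
    proof (cases "M = 0")
      case False
      then show ?thesis
        using binomial_strict_antimono[of "M + 1" "M + 2" "2 * M + 1"] central by simp
    qed simp
    moreover have "(2 * M + 1) choose (M - 2) \<le> (2 * M + 1) choose M"
      by (intro binomial_mono) auto
    moreover have "(if 4 \<le> M + 2 then (2 * M + 1) choose (M - 2) else 0) \<le> (2 * M + 1) choose (M - 2)"
      by simp
    moreover have "M + 2 - 4 = M - 2" "M + 2 - 2 = M" by auto
    ultimately show ?thesis unfolding n 1 by (simp only:)
  next
    case 2
    have "(2 * M + 1) choose (M + 3) \<le> (2 * M + 1) choose (M + 1)"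
    proof (cases "M + 3 \<le> 2 * M + 1")
      case True
      then show ?thesis by (intro binomial_antimono) auto
    qed (simp add: binomial_eq_0)
    moreover have "(if 4 \<le> M + 3 then (2 * M + 1) choose (M - 1) else 0) < (2 * M + 1) choose M"
    proof (cases "M = 0")
      case False
      then show ?thesis using binomial_strict_mono[of "M - 1" M "2 * M + 1"] by simp
    qed simp
    moreover have "M + 3 - 4 = M - 1" "M + 3 - 2 = M + 1" by auto
    ultimately show ?thesis unfolding n 2 using central by (simp only:)
  qed
qed

context simplex
begin

text \<open>The trace of a set on \<open>{1..a}\<close> is meant, not that of an operator: such a
  \<open>J\<close> is \<open>A\<close> together with k - card A elements above
  \<open>a\<close>.\<close>

lemma card_index_sets_trace:
  assumes "A \<subseteq> {1..a}" "a \<le> n"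
  shows "card {J \<in> index_sets k. J \<inter> {1..a} = A} =
    (if card A \<le> k then (n - a) choose (k - card A) else 0)"
proof (cases "card A \<le> k")
  case True
  have finA: "finite A" using assms finite_subset by blast
  let ?K = "{K. K \<subseteq> {Suc a..n} \<and> card K = k - card A}"
  have "bij_betw (\<lambda>K. K \<union> A) ?K {J \<in> index_sets k. J \<inter> {1..a} = A}"
  proof (rule bij_betwI[where g = "\<lambda>J. J - A"])
    show "(\<lambda>K. K \<union> A) \<in> ?K \<rightarrow> {J \<in> index_sets k. J \<inter> {1..a} = A}"
    proof clarify
      fix K assume K: "K \<subseteq> {Suc a..n}" "card K = k - card A"
      have finK: "finite K" using K finite_subset by blast
      have disj: "K \<inter> A = {}" "K \<inter> {1..a} = {}" using K assms by fastforce+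
      have "card (K \<union> A) = k" using finK finA disj K True by (simp add: card_Un_disjoint)
      then show "K \<union> A \<in> index_sets k \<and> (K \<union> A) \<inter> {1..a} = A"
        using K disj assms by (fastforce simp: index_sets_def)
    qed
    show "(\<lambda>J. J - A) \<in> {J \<in> index_sets k. J \<inter> {1..a} = A} \<rightarrow> ?K"
    proof clarify
      fix J assume J: "J \<in> index_sets k" "A = J \<inter> {1..a}"
      have "J - J \<inter> {1..a} \<subseteq> {Suc a..n}" using index_setsD(1)[OF J(1)] by fastforce
      moreover have "card (J - J \<inter> {1..a}) = k - card (J \<inter> {1..a})"
        using index_setsD[OF J(1)] by (simp add: card_Diff_subset)
      ultimately show "J - J \<inter> {1..a} \<subseteq> {Suc a..n} \<and> card (J - J \<inter> {1..a}) = k - card (J \<inter> {1..a})"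
        by simp
    qed
    show "K \<union> A - A = K" if "K \<in> ?K" for K
      using that assms by fastforce
    show "J - A \<union> A = J" if "J \<in> {J \<in> index_sets k. J \<inter> {1..a} = A}" for J
      using that by blast
  qed
  then have "card ?K = card {J \<in> index_sets k. J \<inter> {1..a} = A}"
    by (rule bij_betw_same_card)
  moreover have "card ?K = (n - a) choose (k - card A)"
    by (subst n_subsets) simp_all
  ultimately show ?thesis using True by simp
next
  case False
  have "card A \<le> k" if "J \<in> index_sets k" "J \<inter> {1..a} = A" for J
  proof -
    have "A \<subseteq> J" using that(2) by blast
    then show ?thesis using index_setsD(2,3)[OF that(1)] card_mono[of J A] by simp
  qed
  then have "{J \<in> index_sets k. J \<inter> {1..a} = A} = {}" using False by blast
  then show ?thesis using False by simp
qed

text \<open>The trace of \<open>act \<pi>\<close> on the constant k-forms, its diagonal entries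
  being read off with the dual functionals.\<close>

definition tr :: "nat \<Rightarrow> (nat \<Rightarrow> nat) \<Rightarrow> complex" where
  "tr k \<pi> = (\<Sum>J\<in>index_sets k. coef J (act \<pi> (basic_form J)))"

lemma permutes_with_0:
  assumes "\<pi> permutes {1..n}"
  shows "\<pi> permutes {0..n}"
  using assms by (rule permutes_subset) auto

lemma coef_act_other:
  assumes \<pi>: "\<pi> permutes {1..n}" and J: "J \<in> index_sets k" and K: "K \<in> index_sets k" "\<pi> ` J \<noteq> K"
  shows "coef K (act \<pi> (basic_form J)) = 0"
proof -
  have "set (map \<pi> (sorted_list_of_set J)) \<subseteq> {1..n}"
    using index_setsD[OF J] permutes_image[OF \<pi>] by auto
  then show ?thesis
    unfolding act_basic_form[OF permutes_with_0[OF \<pi>] J]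
    using index_setsD[OF J] K by (intro coef_simplex_form_other) auto
qed

text \<open>Only the restriction of \<pi> to \<open>J\<close> determines the sign. It is represented
  by a separate \<rho>, the identity off \<open>J\<close>, to which \<open>sign\<close>
  applies.\<close>

lemma coef_act_invariant:
  assumes \<pi>: "\<pi> permutes {0..n}" and \<rho>: "\<rho> permutes J" "\<And>x. x \<in> J \<Longrightarrow> \<pi> x = \<rho> x"
    and J: "J \<in> index_sets k"
  shows "coef J (act \<pi> (basic_form J)) = of_int (sign \<rho>)"
proof -
  note JD = index_setsD[OF J]
  have "act \<pi> (basic_form J) = simplex_form (map \<rho> (sorted_list_of_set J))"
    unfolding act_basic_form[OF \<pi> J] using \<rho>(2) JD by (intro arg_cong[where f = simplex_form] map_cong) auto
  also have "\<dots> = form_scale (of_int (sign \<rho>)) (basic_form J)"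
    unfolding basic_form_def using \<rho>(1) JD by (intro simplex_form_map_permutes) auto
  finally show ?thesis using coef_basic_form[OF J J] by simp
qed

text \<open>Sets that are not invariant contribute 0 and invariant ones all contribute
  \<open>e\<close>, so nothing cancels and the trace is \<open>e\<close> times the number of
  invariant sets.\<close>

lemma tr_nonzero:
  assumes \<pi>: "\<pi> permutes {1..n}" and e: "e \<noteq> (0 :: int)"
    and sign: "\<And>J. J \<in> index_sets k \<Longrightarrow> \<pi> ` J = J \<Longrightarrow>
      \<exists>\<rho>. \<rho> permutes J \<and> (\<forall>x\<in>J. \<pi> x = \<rho> x) \<and> sign \<rho> = e"
    and J0: "J0 \<in> index_sets k" "\<pi> ` J0 = J0"
  shows "tr k \<pi> \<noteq> 0"
proof -
  have "coef J (act \<pi> (basic_form J)) = (if \<pi> ` J = J then of_int e else 0)"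
    if J: "J \<in> index_sets k" for J
  proof (cases "\<pi> ` J = J")
    case True
    obtain \<rho> where \<rho>: "\<rho> permutes J" "\<And>x. x \<in> J \<Longrightarrow> \<pi> x = \<rho> x" "sign \<rho> = e"
      using sign[OF J True] by blast
    then show ?thesis
      using True coef_act_invariant[OF permutes_with_0[OF \<pi>] \<rho>(1,2) J] by simp
  qed (use coef_act_other[OF \<pi> J J] in simp)
  then have "tr k \<pi> = (\<Sum>J\<in>index_sets k. if \<pi> ` J = J then of_int e else 0)"
    unfolding tr_def by (intro sum.cong) auto
  also have "\<dots> = of_nat (card {J \<in> index_sets k. \<pi> ` J = J}) * of_int e"
    by (simp add: sum.If_cases Int_def)
  finally show ?thesis using e J0 by auto
qed

lemma cyc_image_eq:
  assumes "cyc a b ` J = J" "J \<inter> {a..b} \<noteq> {}"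
  shows "{a..b} \<subseteq> J"
proof -
  obtain x where "x \<in> J" "a \<le> x" "x \<le> b" using assms(2) by auto
  then show ?thesis using assms(1) by (intro cyc_invariant[of J a b x]) blast+
qed

text \<open>An invariant \<open>J\<close> contains all moved points or avoids them. The bounds on
  \<open>a\<close> permit only one of the two: avoidance, with sign 1, if k < a, and containment,
  with sign (-1)^(a - 1), otherwise.\<close>

lemma tr_cyc_nonzero:
  assumes k: "0 < k" "k < n" and a: "min k (n - k) < a" "a \<le> max k (n - k)"
  shows "tr k (cyc 1 a) \<noteq> 0"
proof -
  have an: "1 \<le> a" "a \<le> n" using a k by auto
  have c: "cyc 1 a permutes {1..n}" using an by (intro cyc_permutes_superset) auto
  have cases: "J \<inter> {1..a} = {} \<or> {1..a} \<subseteq> J" if "cyc 1 a ` J = J" for J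
    using cyc_image_eq[OF that] by blast
  show ?thesis
  proof (cases "k < a")
    case True
    then have a': "a \<le> n - k" using a by auto
    show ?thesis
    proof (rule tr_nonzero[OF c, of 1])
      show "{a + 1..a + k} \<in> index_sets k"
        using a' k by (auto simp: index_sets_def)
      show "cyc 1 a ` {a + 1..a + k} = {a + 1..a + k}"
        by (auto simp: cyc_def image_iff)
      fix J assume J: "J \<in> index_sets k" "cyc 1 a ` J = J"
      have "\<not> {1..a} \<subseteq> J" using True card_mono[of J "{1..a}"] index_setsD[OF J(1)] by auto
      then have "J \<inter> {1..a} = {}" using cases[OF J(2)] by blast
      then have "\<forall>x\<in>J. cyc 1 a x = id x" by (auto simp: cyc_def)
      then show "\<exists>\<rho>. \<rho> permutes J \<and> (\<forall>x\<in>J. cyc 1 a x = \<rho> x) \<and> sign \<rho> = 1"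
        using permutes_id sign_id by blast
    qed simp
  next
    case False
    then have a': "n - k < a" "a \<le> k" using a by auto
    show ?thesis
    proof (rule tr_nonzero[OF c, of "(- 1) ^ (a - 1)"])
      show "{1..k} \<in> index_sets k"
        using k by (auto simp: index_sets_def)
      show "cyc 1 a ` {1..k} = {1..k}"
        using permutes_image[of "cyc 1 a" "{1..k}"] permutes_subset[OF cyc_permutes[OF an(1)], of "{1..k}"] a' by auto
      fix J assume J: "J \<in> index_sets k" "cyc 1 a ` J = J"
      have "J \<inter> {1..a} \<noteq> {}"
      proof
        assume "J \<inter> {1..a} = {}"
        then have "J \<subseteq> {Suc a..n}" using index_setsD(1)[OF J(1)] by fastforce
        then have "card J \<le> n - a" using card_mono[of "{Suc a..n}" J] by simp
        then show False using a' k index_setsD(2)[OF J(1)] an by auto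
      qed
      then have "{1..a} \<subseteq> J" using cases[OF J(2)] by blast
      then have "cyc 1 a permutes J" using an by (intro cyc_permutes_superset)
      then show "\<exists>\<rho>. \<rho> permutes J \<and> (\<forall>x\<in>J. cyc 1 a x = \<rho> x) \<and> sign \<rho> = (- 1) ^ (a - 1)"
        using sign_cyc[OF an(1)] by blast
    qed simp
  qed
qed

text \<open>A 3-cycle is even, so every invariant set contributes 1, and k >= 3 makes
  \<open>{1..k}\<close> invariant. For k = 2 and n = 4 there is no invariant set at all.\<close>

lemma tr_cyc3_nonzero:
  assumes k: "n = 2 * k" "3 \<le> k"
  shows "tr k (cyc 1 3) \<noteq> 0"
proof -
  have c: "cyc 1 3 permutes {1..n}" using k by (intro cyc_permutes_superset) auto
  show ?thesis
  proof (rule tr_nonzero[OF c, of 1])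
    show "{1..k} \<in> index_sets k" unfolding index_sets_def using k by auto
    show "cyc 1 3 ` {1..k} = {1..k}"
      using permutes_image[of "cyc 1 3" "{1..k}"] permutes_subset[OF cyc_permutes[of 1 3], of "{1..k}"] k by auto
    fix J assume J: "J \<in> index_sets k" "cyc 1 3 ` J = J"
    show "\<exists>\<rho>. \<rho> permutes J \<and> (\<forall>x\<in>J. cyc 1 3 x = \<rho> x) \<and> sign \<rho> = 1"
    proof (cases "J \<inter> {1..3} = {}")
      case True
      then have "\<forall>x\<in>J. cyc 1 3 x = id x" by (auto simp: cyc_def)
      then show ?thesis using permutes_id sign_id by blast
    next
      case False
      then have "{1..3} \<subseteq> J" using cyc_image_eq[OF J(2)] by simp
      then have "cyc 1 3 permutes J" by (intro cyc_permutes_superset) auto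
      moreover have "sign (cyc 1 3) = 1" using sign_cyc[of 1 3] by simp
      ultimately show ?thesis by blast
    qed
  qed simp
qed

lemma two_cycles_permutes:
  assumes "0 < k" "k < n"
  shows "cyc 1 k \<circ> cyc (Suc k) n permutes {1..n}"
proof (rule permutes_compose)
  show "cyc (Suc k) n permutes {1..n}"
    using assms by (intro cyc_permutes_superset) auto
  show "cyc 1 k permutes {1..n}"
    using assms by (intro cyc_permutes_superset) auto
qed

text \<open>The only invariant k-sets are \<open>{1..k}\<close> and, if n = 2 k, also
  \<open>{Suc k..n}\<close>. Both carry a k-cycle, so their signs agree.\<close>

lemma tr_two_cycles_nonzero:
  assumes k: "0 < k" "k < n"
  shows "tr k (cyc 1 k \<circ> cyc (Suc k) n) \<noteq> 0"
proof (rule tr_nonzero[OF two_cycles_permutes[OF k], of "(- 1) ^ (k - 1)"])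
  let ?g = "cyc 1 k \<circ> cyc (Suc k) n"
  have g1: "?g x = cyc 1 k x" if "x \<in> {1..k}" for x
    using that k by (simp add: cyc_def)
  have g2: "?g x = cyc (Suc k) n x" if "x \<in> {Suc k..n}" for x
    using that k by (simp add: cyc_def)
  show "{1..k} \<in> index_sets k" using k by (auto simp: index_sets_def)
  have "?g ` {1..k} = cyc 1 k ` {1..k}" using g1 by (intro image_cong) auto
  then show "?g ` {1..k} = {1..k}" using permutes_image[OF cyc_permutes[of 1 k]] k by simp
  fix J assume J: "J \<in> index_sets k" "?g ` J = J"
  note JD = index_setsD[OF J(1)]
  have gJ: "?g x \<in> J" if "x \<in> J" for x using J(2) that by blast
  have inv1: "cyc 1 k x \<in> J" if "x \<in> J" "1 \<le> x" "x \<le> k" for x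
    using gJ[OF that(1)] g1[of x] that by simp
  have inv2: "cyc (Suc k) n x \<in> J" if "x \<in> J" "Suc k \<le> x" "x \<le> n" for x
    using gJ[OF that(1)] g2[of x] that by simp
  show "\<exists>\<rho>. \<rho> permutes J \<and> (\<forall>x\<in>J. ?g x = \<rho> x) \<and> sign \<rho> = (- 1) ^ (k - 1)"
  proof (cases "J \<inter> {1..k} = {}")
    case False
    have "{1..k} \<subseteq> J"
    proof -
      obtain x where "x \<in> J" "1 \<le> x" "x \<le> k" using False by auto
      then show ?thesis using inv1 by (intro cyc_invariant[of J 1 k x]) blast+
    qed
    then have "J = {1..k}" using card_subset_eq[of J "{1..k}"] JD by auto
    then show ?thesis using cyc_permutes[of 1 k] sign_cyc[of 1 k] g1 k by (intro exI[of _ "cyc 1 k"]) auto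
  next
    case True
    then have sub: "J \<subseteq> {Suc k..n}" using JD(1) by fastforce
    have "J \<noteq> {}" using JD(2) k by auto
    then obtain x where "x \<in> J" by blast
    then have "{Suc k..n} \<subseteq> J"
      using inv2 sub by (intro cyc_invariant[of J "Suc k" n x]) auto
    then have eq: "J = {Suc k..n}" using sub by blast
    then have "n - Suc k = k - 1" using JD(2) by simp
    then have "sign (cyc (Suc k) n) = (- 1) ^ (k - 1)"
      using sign_cyc[of "Suc k" n] k by simp
    then show ?thesis using cyc_permutes[of "Suc k" n] eq g2 k by (intro exI[of _ "cyc (Suc k) n"]) auto
  qed
qed simp

text \<open>Here 0 is moved, so basic forms are not merely permuted up to sign. If \<open>J\<close>
  lacks \<open>n\<close>, the image is a wedge over the shifted set, which is not \<open>J\<close>.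
  If \<open>J\<close> contains \<open>n\<close>, the factor \<open>d\<lambda>_n\<close> becomes
  \<open>d\<lambda>_0\<close> and is expanded; a term over \<open>J\<close> arises only if the shift
  of J - {n} stays in \<open>J\<close>, which forces J = {n - k + 1..n}. A single diagonal entry, 1
  or -1, remains.\<close>

lemma tr_long_cycle_nonzero:
  assumes k: "0 < k" "k < n"
  shows "tr k (cyc 0 n) \<noteq> 0"
proof -
  let ?c = "cyc 0 n"
  let ?J0 = "{n - k + 1..n}"
  have c: "?c permutes {0..n}" by (rule cyc_permutes) simp
  have J0: "?J0 \<in> index_sets k" using k by (auto simp: index_sets_def)
  have up: "J = ?J0" if J: "J \<in> index_sets k" "n \<in> J" "Suc ` (J - {n}) \<subseteq> J" for J
  proof -
    note JD = index_setsD[OF J(1)]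
    have step: "y \<in> J" if "x \<le> y" "x \<in> J" "y \<le> n" for x y
      using that
    proof (induction rule: dec_induct)
      case (step m)
      then have "m \<in> J - {n}" by auto
      then show ?case using J(3) by blast
    qed
    have "Min J \<in> J" using JD J(2) by (intro Min_in) auto
    then have "{Min J..n} \<subseteq> J" using step[of "Min J"] by auto
    moreover have "J \<subseteq> {Min J..n}" using JD by fastforce
    ultimately have eq: "J = {Min J..n}" by blast
    then have "n + 1 - Min J = k" using JD(2) by (metis Suc_eq_plus1 card_atLeastAtMost)
    then have "Min J = n - k + 1" using k by simp
    then show ?thesis using eq by simp
  qed
  have coef: "coef J (act ?c (basic_form J)) = 0 \<longleftrightarrow> J \<noteq> ?J0" if J: "J \<in> index_sets k" for J
  proof (cases "n \<in> J")
    case False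
    note JD = index_setsD[OF J]
    let ?L = "sorted_list_of_set J"
    have m: "map ?c ?L = map Suc ?L"
    proof (rule map_cong)
      fix x assume "x \<in> set ?L"
      then have "x < n" using JD(1,4) False by (metis atLeastAtMost_iff le_neq_implies_less subsetD)
      then show "?c x = Suc x" by (simp add: cyc_def)
    qed simp
    have "Suc ` J \<noteq> J"
    proof
      assume eq: "Suc ` J = J"
      have "J \<noteq> {}" using JD k by auto
      then have "Max J \<in> J" "finite J" using JD by auto
      then have "Suc (Max J) \<in> J" using eq by blast
      then show False using Max_ge[OF \<open>finite J\<close>] by (metis Suc_n_not_le_n)
    qed
    moreover have "Suc ` J \<subseteq> {1..n}"
    proof clarify
      fix x assume "x \<in> J"
      then have "x \<noteq> n" "x \<in> {1..n}" using JD(1) False by blast+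
      then show "Suc x \<in> {1..n}" by simp
    qed
    ultimately have "coef J (act ?c (basic_form J)) = 0"
      unfolding act_basic_form[OF c J] m
      by (intro coef_simplex_form_other[OF J]) (simp_all only: set_map JD(4,5) length_map not_False_eq_True)
    moreover have "J \<noteq> ?J0" using False k by auto
    ultimately show ?thesis by simp
  next
    case True
    note JD = index_setsD[OF J]
    let ?L = "sorted_list_of_set J"
    \<comment> \<open>On \<open>J\<close>, \<open>f l\<close> is the cycle with the image of
      \<open>n\<close>, originally 0, replaced by \<open>l\<close>.\<close>
    define f where "f l x = (if x = n then l else Suc x)" for l x :: nat
    obtain p where p: "p < length ?L" "?L ! p = n" using True JD(4) by (metis in_set_conv_nth)
    have upd: "(map ?c ?L)[p := l] = map (f l) ?L" for l
    proof (rule nth_equalityI)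
      fix i assume "i < length ((map ?c ?L)[p := l])"
      then have i: "i < length ?L" by simp
      then have "?L ! i \<in> J" using JD(4) nth_mem by blast
      moreover have "?L ! i = n \<longleftrightarrow> i = p"
        using nth_eq_iff_index_eq[OF _ i p(1)] p(2) by auto
      ultimately show "(map ?c ?L)[p := l] ! i = map (f l) ?L ! i"
        using i JD(1) by (auto simp: nth_list_update f_def cyc_def)
    qed simp
    have 0: "(map ?c ?L)[p := 0] = map ?c ?L"
    proof -
      have "map ?c ?L ! p = 0" using p by (simp add: cyc_def)
      then show ?thesis using list_update_id[of "map ?c ?L" p] by simp
    qed
    have f0: "map (f 0) ?L = map ?c ?L" using upd[of 0] 0 by simp
    have "{..n} = insert 0 {1..n}" by auto
    then have "coef J (simplex_form (map ?c ?L)) + (\<Sum>l\<in>{1..n}. coef J (simplex_form (map (f l) ?L))) = 0"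
      using arg_cong[OF sum_simplex_form[of p "map ?c ?L"], of "coef J"] p(1) by (simp add: upd f0)
    then have eq: "coef J (act ?c (basic_form J)) = - (\<Sum>l\<in>{1..n}. coef J (simplex_form (map (f l) ?L)))"
      unfolding act_basic_form[OF c J] by (simp add: add_eq_0_iff2)
    have fJ: "f l ` J = insert l (Suc ` (J - {n}))" for l
      using True by (auto simp: f_def image_iff)
    have f_sub: "set (map (f l) ?L) \<subseteq> {1..n}" if "l \<in> {1..n}" for l
    proof
      fix y assume "y \<in> set (map (f l) ?L)"
      then obtain x where "x \<in> {1..n}" "y = f l x" using JD(1,4) by auto
      then show "y \<in> {1..n}" using that by (auto simp: f_def)
    qed
    have other: "coef J (simplex_form (map (f l) ?L)) = 0" if "l \<in> {1..n}" "f l ` J \<noteq> J" for l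
      using coef_simplex_form_other[OF J f_sub[OF that(1)]] that(2) JD(4,5) by simp
    show ?thesis
    proof (cases "J = ?J0")
      case False
      have "f l ` J \<noteq> J" for l
        using up[OF J True] False fJ[of l] by blast
      then show ?thesis using other False eq by simp
    next
      case J_eq: True
      \<comment> \<open>The shift vacates the least element of \<open>J\<close>, and only this index
        fills the gap.\<close>
      let ?l = "n - k + 1"
      have l: "?l \<in> {1..n}" using k by simp
      have fl: "f ?l ` J = J"
      proof -
        have "Suc ` ({n - k + 1..n} - {n}) = {n - k + 2..n}"
        proof -
          have "{n - k + 1..n} - {n} = {n - k + 1..<n}" by auto
          then show ?thesis by (simp add: image_Suc_atLeastLessThan atLeastLessThanSuc_atLeastAtMost)
        qed
        moreover have "insert (n - k + 1) {n - k + 2..n} = {n - k + 1..n}" using k by auto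
        ultimately show ?thesis unfolding fJ by (simp add: J_eq)
      qed
      have "f l ` J \<noteq> J" if "l \<noteq> ?l" for l
      proof
        assume "f l ` J = J"
        then have "?l \<in> insert l (Suc ` (J - {n}))" using fJ[of l] J_eq l k by auto
        then have "n - k \<in> J" using that by auto
        then show False using J_eq by auto
      qed
      then have "(\<Sum>l\<in>{1..n}. coef J (simplex_form (map (f l) ?L)))
          = (\<Sum>l\<in>{1..n}. if l = ?l then coef J (simplex_form (map (f ?l) ?L)) else 0)"
        using other by (intro sum.cong) auto
      also have "\<dots> = coef J (simplex_form (map (f ?l) ?L))" using l by simp
      finally have eq': "coef J (act ?c (basic_form J)) = - coef J (simplex_form (map (f ?l) ?L))"
        using eq by simp
      have "inj_on (f ?l) J" using fl JD(3) by (metis eq_card_imp_inj_on)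
      then have "mset (map (f ?l) ?L) = mset ?L"
        using fl JD(3,4) by (metis distinct_map distinct_sorted_list_of_set set_eq_iff_mset_eq_distinct set_map)
      then obtain d where "d = 1 \<or> d = - 1"
        "simplex_form (map (f ?l) ?L) = form_scale d (basic_form J)"
        unfolding basic_form_def by (rule simplex_form_mset_eq)
      then show ?thesis using eq' J_eq coef_basic_form[OF J J] by auto
    qed
  qed
  have "tr k ?c = (\<Sum>J\<in>index_sets k. if J = ?J0 then coef ?J0 (act ?c (basic_form ?J0)) else 0)"
    unfolding tr_def using coef by (intro sum.cong) auto
  also have "\<dots> = coef ?J0 (act ?c (basic_form ?J0))" using J0 by simp
  finally show ?thesis using coef[OF J0] by simp
qed

text \<open>A set with exactly one of 1 and 2 is moved; one with neither contributes 1, and one with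
  both contributes -1.\<close>

lemma tr_transposition:
  assumes "2 \<le> n"
  shows "tr k (cyc 1 2) = of_nat ((n - 2) choose k) - of_nat (if 2 \<le> k then (n - 2) choose (k - 2) else 0)"
proof -
  have c: "cyc 1 2 permutes {1..n}" using assms by (intro cyc_permutes_superset) auto
  have "coef J (act (cyc 1 2) (basic_form J)) =
      of_bool (J \<inter> {1..2} = {}) - of_bool (J \<inter> {1..2} = {1..2})" if J: "J \<in> index_sets k" for J
  proof -
    consider "J \<inter> {1..2} = {}" | "{1..2} \<subseteq> J" | "J \<inter> {1..2} \<noteq> {}" "\<not> {1..2} \<subseteq> J" by blast
    then show ?thesis
    proof cases
      case 1
      then have "\<forall>x\<in>J. cyc 1 2 x = id x" by (auto simp: cyc_def)
      then show ?thesis using 1 coef_act_invariant[OF permutes_with_0[OF c] permutes_id _ J] by simp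
    next
      case 2
      then have "cyc 1 2 permutes J" by (intro cyc_permutes_superset) auto
      then show ?thesis
        using 2 coef_act_invariant[OF permutes_with_0[OF c] _ _ J, of "cyc 1 2"] sign_cyc[of 1 2]
        by (auto simp: Int_absorb1)
    next
      case 3
      then have "cyc 1 2 ` J \<noteq> J" using cyc_image_eq[of 1 2 J] by auto
      then show ?thesis using 3 coef_act_other[OF c J J] by auto
    qed
  qed
  then have "tr k (cyc 1 2) = (\<Sum>J\<in>index_sets k. of_bool (J \<inter> {1..2} = {}) - of_bool (J \<inter> {1..2} = {1..2}))"
    unfolding tr_def by (rule sum.cong[OF refl])
  also have "\<dots> = of_nat (card {J \<in> index_sets k. J \<inter> {1..2} = {}})
      - of_nat (card {J \<in> index_sets k. J \<inter> {1..2} = {1..2}})"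
    by (simp add: sum_subtractf Int_def)
  finally show ?thesis
    using card_index_sets_trace[of "{}" 2 k] card_index_sets_trace[of "{1..2}" 2 k] assms by simp
qed

text \<open>Contributions come from the sets meeting \<open>{1..4}\<close> in a union of the
  transposed pairs, with a factor -1 for each pair contained.\<close>

lemma tr_double_transposition:
  assumes "4 \<le> n" "2 \<le> k"
  shows "tr k (cyc 1 2 \<circ> cyc 3 4) = of_nat ((n - 4) choose k) - 2 * of_nat ((n - 4) choose (k - 2))
    + of_nat (if 4 \<le> k then (n - 4) choose (k - 4) else 0)"
proof -
  let ?d = "cyc 1 2 \<circ> cyc 3 4"
  have p12: "cyc 1 2 permutes {1..2}" and p34: "cyc 3 4 permutes {3..4}" by (rule cyc_permutes; simp)+
  have c: "?d permutes {1..n}"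
    using assms by (intro permutes_compose permutes_subset[OF p12] permutes_subset[OF p34]) auto
  have d: "?d 1 = 2" "?d 2 = 1" "?d 3 = 4" "?d 4 = 3" "x \<notin> {1..4} \<Longrightarrow> ?d x = x" for x
    by (auto simp: cyc_def)
  have s12: "sign (cyc 1 2) = - 1" and s34: "sign (cyc 3 4) = - 1"
    using sign_cyc[of 1 2] sign_cyc[of 3 4] by simp_all
  have sd: "sign ?d = 1"
    using sign_compose[of "cyc 1 2" "cyc 3 4"] permutes_imp_permutation[OF _ p12]
      permutes_imp_permutation[OF _ p34] s12 s34 by simp
  have ne: "{1, 2} \<noteq> {3, 4::nat}" "{1, 2} \<noteq> {1, 2, 3, 4::nat}" "{3, 4} \<noteq> {1, 2, 3, 4::nat}"
  proof -
    have "3 \<notin> {1, 2::nat}" "3 \<in> {3, 4::nat}" "3 \<in> {1, 2, 3, 4::nat}" "1 \<notin> {3, 4::nat}"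
      "1 \<in> {1, 2, 3, 4::nat}" by simp_all
    then show "{1, 2} \<noteq> {3, 4::nat}" "{1, 2} \<noteq> {1, 2, 3, 4::nat}" "{3, 4} \<noteq> {1, 2, 3, 4::nat}"
      by metis+
  qed
  have set4: "{1..4} = {1, 2, 3, 4::nat}" by auto
  have "coef J (act ?d (basic_form J)) = of_bool (J \<inter> {1..4} = {}) - of_bool (J \<inter> {1..4} = {1, 2})
      - of_bool (J \<inter> {1..4} = {3, 4}) + of_bool (J \<inter> {1..4} = {1, 2, 3, 4})"
    if J: "J \<in> index_sets k" for J
  proof -
    note inv = coef_act_invariant[OF permutes_with_0[OF c] _ _ J]
    consider "J \<inter> {1..4} = {}" | "J \<inter> {1..4} = {1, 2}" | "J \<inter> {1..4} = {3, 4}"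
      | "J \<inter> {1..4} = {1, 2, 3, 4}"
      | "J \<inter> {1..4} \<noteq> {}" "J \<inter> {1..4} \<noteq> {1, 2}" "J \<inter> {1..4} \<noteq> {3, 4}" "J \<inter> {1..4} \<noteq> {1, 2, 3, 4}"
      by blast
    then show ?thesis
    proof cases
      case 1
      then have "?d x = id x" if "x \<in> J" for x
        using d(5)[of x] that by (metis disjoint_iff id_apply)
      then show ?thesis using 1 inv[OF permutes_id] by simp
    next
      case 2
      have "x \<in> J \<longleftrightarrow> x \<in> {1, 2}" if "x \<in> {1..4}" for x using 2 that by blast
      from this[of 1] this[of 2] this[of 3] this[of 4]
      have J12: "1 \<in> J" "2 \<in> J" "3 \<notin> J" "4 \<notin> J" by simp_all
      moreover have "{1..2} = {1, 2::nat}" by auto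
      ultimately have "cyc 1 2 permutes J" by (intro permutes_subset[OF p12]) simp
      moreover have "?d x = cyc 1 2 x" if "x \<in> J" for x
      proof -
        have "x \<noteq> 3" "x \<noteq> 4" using J12 that by auto
        then show ?thesis by (simp add: cyc_def)
      qed
      ultimately show ?thesis using 2 ne inv[of "cyc 1 2"] s12 by (simp del: One_nat_def)
    next
      case 3
      have "x \<in> J \<longleftrightarrow> x \<in> {3, 4}" if "x \<in> {1..4}" for x using 3 that by blast
      from this[of 1] this[of 2] this[of 3] this[of 4]
      have J34: "1 \<notin> J" "2 \<notin> J" "3 \<in> J" "4 \<in> J" by simp_all
      moreover have "{3..4} = {3, 4::nat}" by auto
      ultimately have "cyc 3 4 permutes J" by (intro permutes_subset[OF p34]) simp
      moreover have "?d x = cyc 3 4 x" if "x \<in> J" for x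
      proof -
        have "x \<noteq> 1" "x \<noteq> 2" using J34 that by metis+
        then show ?thesis by (simp add: cyc_def)
      qed
      ultimately show ?thesis using 3 ne inv[of "cyc 3 4"] s34 by (simp del: One_nat_def)
    next
      case 4
      then have "{1..4} \<subseteq> J" unfolding set4 by blast
      then have "?d permutes J"
        by (intro permutes_compose permutes_subset[OF p12] permutes_subset[OF p34]) auto
      then show ?thesis using 4 ne inv[of ?d] sd by (simp del: One_nat_def)
    next
      case 5
      have "?d ` J \<noteq> J"
      proof
        assume eq: "?d ` J = J"
        then have "?d x \<in> J" if "x \<in> J" for x using that by blast
        from this[of 1] this[of 2] this[of 3] this[of 4]
        have "1 \<in> J \<longleftrightarrow> 2 \<in> J" "3 \<in> J \<longleftrightarrow> 4 \<in> J" unfolding d by blast+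
        then have "J \<inter> {1..4} = (if 1 \<in> J then {1, 2} else {}) \<union> (if 3 \<in> J then {3, 4} else {})"
          unfolding set4 by auto
        then show False using 5 by (cases "1 \<in> J"; cases "3 \<in> J") (simp_all add: insert_commute)
      qed
      then show ?thesis using 5 coef_act_other[OF c J J] by simp
    qed
  qed
  then have "tr k ?d = (\<Sum>J\<in>index_sets k. of_bool (J \<inter> {1..4} = {}) - of_bool (J \<inter> {1..4} = {1, 2})
      - of_bool (J \<inter> {1..4} = {3, 4}) + of_bool (J \<inter> {1..4} = {1, 2, 3, 4}))"
    unfolding tr_def by (rule sum.cong[OF refl])
  also have "\<dots> = of_nat (card {J \<in> index_sets k. J \<inter> {1..4} = {}})
      - of_nat (card {J \<in> index_sets k. J \<inter> {1..4} = {1, 2}})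
      - of_nat (card {J \<in> index_sets k. J \<inter> {1..4} = {3, 4}})
      + of_nat (card {J \<in> index_sets k. J \<inter> {1..4} = {1, 2, 3, 4}})"
    by (simp add: sum_subtractf sum.distrib Int_def)
  also have "card {J \<in> index_sets k. J \<inter> {1..4} = {}} = (n - 4) choose k"
    using assms by (subst card_index_sets_trace) simp_all
  also have "card {J \<in> index_sets k. J \<inter> {1..4} = {1, 2}} = (n - 4) choose (k - 2)"
    using assms by (subst card_index_sets_trace) (simp_all add: numeral_2_eq_2)
  also have "card {J \<in> index_sets k. J \<inter> {1..4} = {3, 4}} = (n - 4) choose (k - 2)"
    using assms by (subst card_index_sets_trace) (simp_all add: numeral_2_eq_2)
  also have "card {J \<in> index_sets k. J \<inter> {1..4} = {1, 2, 3, 4}}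
      = (if 4 \<le> k then (n - 4) choose (k - 4) else 0)"
  proof -
    have c4: "card {1, 2, 3, 4::nat} = 4" by simp
    show ?thesis
      using assms card_index_sets_trace[of "{1, 2, 3, 4}" 4 k, unfolded c4] unfolding set4 by simp
  qed
  finally show ?thesis unfolding mult_2 diff_diff_eq .
qed

end

section \<open>Monomial bases\<close>

locale monomial_basis = simplex n v for n and v :: "nat \<Rightarrow> 'a::euclidean_space" +
  fixes k :: nat and B :: "'a cform set"
  assumes k: "0 < k" "k < n"
    and basis: "form_basis B (constant_forms n v k)"
    and invariant: "C_invariant n v B"
begin

abbreviation V where "V \<equiv> constant_forms n v k"

lemma finite_B [simp]: "finite B"
  and independent_B: "\<not> cform.dependent B"
  and span_B: "cform.span B = V"
  using basis invariant by (auto simp: form_basis_def C_invariant_def)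

lemma B_in_V: "b \<in> B \<Longrightarrow> b \<in> V"
  using span_B cform.span_base by blast

lemma B_nonzero: "b \<in> B \<Longrightarrow> b \<noteq> 0"
  using independent_B cform.dependent_zero by blast

lemma act_basis:
  assumes "\<pi> permutes {0..n}" "b \<in> B"
  obtains c b' where "cmod c = 1" "b' \<in> B" "act \<pi> b = form_scale c b'"
proof -
  obtain \<tau> c where \<tau>: "\<tau> permutes B"
    "\<forall>\<omega>\<in>B. cmod (c \<omega>) = 1 \<and> act \<pi> \<omega> = form_scale (c \<omega>) (\<tau> \<omega>)"
    using invariant assms(1) unfolding C_invariant_def act_def by blast
  then show ?thesis
    using that[of "c b" "\<tau> b"] assms(2) permutes_in_image[OF \<tau>(1)] by blast
qed

text \<open>The diagonal entry at \<open>b\<close> of the matrix of \<open>act \<pi>\<close> in the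
  basis \<open>B\<close>. For \<open>b\<close> in \<open>B\<close> it is a linear character on the
  stabiliser of the line of \<open>b\<close>, and 0 on the other permutations of
  \<open>{0..n}\<close>.\<close>

definition chi :: "'a cform \<Rightarrow> (nat \<Rightarrow> nat) \<Rightarrow> complex" where
  "chi b \<pi> = cform.representation B (act \<pi> b) b"

text \<open>The stabiliser of the line of \<open>b\<close>, not of the vector: the group H of the
  overview.\<close>

definition stab :: "'a cform \<Rightarrow> (nat \<Rightarrow> nat) set" where
  "stab b = {\<pi>. \<pi> permutes {0..n} \<and> (\<exists>c. act \<pi> b = form_scale c b)}"

lemma representation_scaled_basis:
  "b' \<in> B \<Longrightarrow> cform.representation B (form_scale c b') b = (if b = b' then c else 0)"
  using cform.representation_scale[OF independent_B cform.span_base[of b' B]]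
    cform.representation_basis[OF independent_B, of b'] by simp

lemma chi_eq: "b \<in> B \<Longrightarrow> act \<pi> b = form_scale c b \<Longrightarrow> chi b \<pi> = c"
  by (simp add: chi_def representation_scaled_basis)

lemma act_stab: "b \<in> B \<Longrightarrow> \<pi> \<in> stab b \<Longrightarrow> act \<pi> b = form_scale (chi b \<pi>) b"
  using chi_eq unfolding stab_def by auto

lemma stab_permutes: "\<pi> \<in> stab b \<Longrightarrow> \<pi> permutes {0..n}"
  by (simp add: stab_def)

lemma chi_outside:
  assumes "b \<in> B" "\<pi> permutes {0..n}" "\<pi> \<notin> stab b"
  shows "chi b \<pi> = 0"
proof -
  obtain c b' where "b' \<in> B" "act \<pi> b = form_scale c b'"
    using act_basis[OF assms(2,1)] by blast
  then show ?thesis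
    using assms by (auto simp: chi_def representation_scaled_basis stab_def)
qed

lemma chi_comp:
  assumes "b \<in> B" "\<pi> \<in> stab b" "\<sigma> \<in> stab b"
  shows "act (\<pi> \<circ> \<sigma>) b = form_scale (chi b \<pi> * chi b \<sigma>) b"
proof -
  have "act (\<pi> \<circ> \<sigma>) b = act \<pi> (act \<sigma> b)"
    using act_comp[OF stab_permutes[OF assms(2)] stab_permutes[OF assms(3)] B_in_V[OF assms(1)]] by simp
  then show ?thesis
    by (simp add: act_stab assms mult.commute)
qed

lemma act_inv_act:
  assumes "\<pi> permutes {0..n}" "\<omega> \<in> V"
  shows "act (inv \<pi>) (act \<pi> \<omega>) = \<omega>" "act \<pi> (act (inv \<pi>) \<omega>) = \<omega>"
  using act_comp[OF permutes_inv[OF assms(1)] assms(1) assms(2)]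
    act_comp[OF assms(1) permutes_inv[OF assms(1)] assms(2)] act_id[OF assms(2)]
  by (simp_all add: permutes_inv_o[OF assms(1)])

lemma act_inv_scaled:
  assumes \<pi>: "\<pi> permutes {0..n}" and b: "b \<in> B" "b' \<in> B" and eq: "act \<pi> b = form_scale c b'"
  shows "c \<noteq> 0" "act (inv \<pi>) b' = form_scale (inverse c) b"
proof -
  have b_eq: "b = form_scale c (act (inv \<pi>) b')"
    using act_inv_act(1)[OF \<pi> B_in_V[OF b(1)]] eq by simp
  then show c: "c \<noteq> 0" using B_nonzero[OF b(1)] by auto
  show "act (inv \<pi>) b' = form_scale (inverse c) b"
    using arg_cong[OF b_eq, of "form_scale (inverse c)"] c by simp
qed

lemma perm_group_stab:
  assumes "b \<in> B"
  shows "perm_group_nat n (stab b)"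
proof
  show "id \<in> stab b"
    using act_id[OF B_in_V[OF assms]] by (auto simp: stab_def permutes_id intro!: exI[of _ 1])
  show "\<pi> \<circ> \<sigma> \<in> stab b" if "\<pi> \<in> stab b" "\<sigma> \<in> stab b" for \<pi> \<sigma>
    using chi_comp[OF assms that] permutes_compose[OF stab_permutes[OF that(2)] stab_permutes[OF that(1)]]
    by (auto simp: stab_def)
  show "inv \<pi> \<in> stab b" if "\<pi> \<in> stab b" for \<pi>
    using act_inv_scaled(2)[OF stab_permutes[OF that] assms assms act_stab[OF assms that]]
      permutes_inv[OF stab_permutes[OF that]] by (auto simp: stab_def)
qed (rule stab_permutes)

text \<open>Independence of the trace from the basis, with \<open>coef\<close> dual to the basic
  forms and \<open>cform.representation B\<close> dual to \<open>B\<close>: both sides are the same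
  double sum.\<close>

lemma tr_eq_sum_chi:
  assumes \<pi>: "\<pi> permutes {0..n}"
  shows "tr k \<pi> = (\<Sum>b\<in>B. chi b \<pi>)"
proof -
  let ?R = "cform.representation B"
  let ?a = "\<lambda>J. act \<pi> (basic_form J)"
  have aV: "?a J \<in> cform.span B" if "J \<in> index_sets k" for J
    using act_in_constant_forms[OF \<pi>] basic_form_in_constant_forms[OF that] by (simp add: span_B)
  have "chi b \<pi> = (\<Sum>J\<in>index_sets k. coef J b * ?R (?a J) b)" if b: "b \<in> B" for b
  proof -
    have "act \<pi> b = act \<pi> (\<Sum>J\<in>index_sets k. form_scale (coef J b) (basic_form J))"
      using constant_forms_expand[OF B_in_V[OF b]] by (rule arg_cong)
    also have "\<dots> = (\<Sum>J\<in>index_sets k. form_scale (coef J b) (?a J))"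
      by (simp only: act_sum act_linear)
    finally have "chi b \<pi> = ?R (\<Sum>J\<in>index_sets k. form_scale (coef J b) (?a J)) b"
      by (simp only: chi_def)
    also have "\<dots> = (\<Sum>J\<in>index_sets k. ?R (form_scale (coef J b) (?a J)) b)"
      by (subst cform.representation_sum[OF independent_B]) (auto intro: cform.span_scale aV)
    also have "\<dots> = (\<Sum>J\<in>index_sets k. coef J b * ?R (?a J) b)"
      by (rule sum.cong[OF refl]) (simp add: cform.representation_scale[OF independent_B aV])
    finally show ?thesis .
  qed
  then have "(\<Sum>b\<in>B. chi b \<pi>) = (\<Sum>b\<in>B. \<Sum>J\<in>index_sets k. coef J b * ?R (?a J) b)"
    by (rule sum.cong[OF refl])
  also have "\<dots> = (\<Sum>J\<in>index_sets k. \<Sum>b\<in>B. coef J b * ?R (?a J) b)"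
    by (rule sum.swap)
  also have "\<dots> = (\<Sum>J\<in>index_sets k. coef J (?a J))"
  proof (rule sum.cong)
    fix J assume "J \<in> index_sets k"
    then have "?a J = (\<Sum>b\<in>B. form_scale (?R (?a J) b) b)"
      using cform.sum_representation_eq[OF independent_B aV finite_B order.refl] by simp
    then have "coef J (?a J) = coef J (\<Sum>b\<in>B. form_scale (?R (?a J) b) b)"
      by (rule arg_cong)
    then show "(\<Sum>b\<in>B. coef J b * ?R (?a J) b) = coef J (?a J)"
      by (simp only: coef_linear mult.commute)
  qed simp
  finally show ?thesis by (simp add: tr_def)
qed

text \<open>Irreducibility: a nonzero multiple of a basic form generates \<open>V\<close>, and by
  \<open>invariants_of_transpositions\<close> both components of a basic form with respect to an invariant
  splitting of the basis are such multiples.\<close>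

lemma stable_subset_eq:
  assumes Y: "Y \<subseteq> B" "\<And>\<pi> b. \<pi> permutes {0..n} \<Longrightarrow> b \<in> Y \<Longrightarrow> act \<pi> b \<in> cform.span Y"
    and I: "I \<in> index_sets k" "basic_form I \<in> cform.span Y"
  shows "Y = B"
proof -
  have stable: "act \<pi> u \<in> cform.span Y" if \<pi>: "\<pi> permutes {0..n}" and "u \<in> cform.span Y" for \<pi> u
    using that(2)
  proof (induction rule: cform.span_induct_alt)
    case base
    then show ?case by (simp add: cform.span_zero)
  next
    case (step c x y)
    then show ?case using Y(2)[OF \<pi>] by (simp add: cform.span_add cform.span_scale)
  qed
  have "basic_form J \<in> cform.span Y" if J: "J \<in> index_sets k" for J
  proof -
    note ID = index_setsD[OF I(1)] and JD = index_setsD[OF J]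
    obtain \<pi> where \<pi>: "\<pi> permutes {0..n}" "\<pi> ` I = J"
    proof (rule ex_permutes_image[of I "{0..n}" J])
      show "I \<subseteq> {0..n}" "J \<subseteq> {0..n}" using ID(1) JD(1) by auto
      show "card I = card J" using ID(2) JD(2) by simp
    qed simp
    have "distinct (map \<pi> (sorted_list_of_set I))"
      using permutes_inj_on[OF \<pi>(1)] by (simp add: distinct_map)
    then have "mset (sorted_list_of_set J) = mset (map \<pi> (sorted_list_of_set I))"
      using ID(4) JD(4) \<pi>(2)
      by (metis distinct_sorted_list_of_set set_eq_iff_mset_eq_distinct set_map)
    then obtain d where "basic_form J = form_scale d (simplex_form (map \<pi> (sorted_list_of_set I)))"
      unfolding basic_form_def by (rule simplex_form_mset_eq)
    then show ?thesis
      using stable[OF \<pi>(1) I(2)] unfolding act_basic_form[OF \<pi>(1) I(1)]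
      by (simp add: cform.span_scale)
  qed
  then have V_sub: "u \<in> cform.span Y" if "u \<in> V" for u
  proof -
    have "(\<Sum>J\<in>index_sets k. form_scale (coef J u) (basic_form J)) \<in> cform.span Y"
      using \<open>\<And>J. J \<in> index_sets k \<Longrightarrow> basic_form J \<in> cform.span Y\<close>
      by (intro cform.span_sum cform.span_scale)
    then show ?thesis by (simp only: constant_forms_expand[OF that, symmetric])
  qed
  show ?thesis
  proof (rule ccontr)
    assume "Y \<noteq> B"
    then obtain b where b: "b \<in> B" "b \<notin> Y" using Y(1) by blast
    then have "Y \<subseteq> B - {b}" using Y(1) by blast
    then have "b \<in> cform.span (B - {b})"
      using V_sub[OF B_in_V[OF b(1)]] cform.span_mono by blast
    then show False using independent_B b(1) unfolding cform.dependent_def by blast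
  qed
qed

lemma act_transitive:
  assumes "b \<in> B" "b' \<in> B"
  obtains \<pi> c where "\<pi> permutes {0..n}" "act \<pi> b = form_scale c b'"
proof -
  \<comment> \<open>\<open>Y\<close> collects the basis elements whose lines are in the orbit of the
    line of \<open>b\<close>, \<open>Z\<close> the others; both spans are stable under the
    group.\<close>
  define Y where "Y = {b' \<in> B. \<exists>\<pi> c. \<pi> permutes {0..n} \<and> act \<pi> b = form_scale c b'}"
  define Z where "Z = B - Y"
  have YB: "Y \<subseteq> B" "Z \<subseteq> B" by (auto simp: Y_def Z_def)
  have bY: "b \<in> Y"
  proof -
    have "id permutes {0..n} \<and> act id b = form_scale 1 b"
      using act_id[OF B_in_V[OF assms(1)]] by (simp add: permutes_id)
    then show ?thesis using assms(1) unfolding Y_def by blast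
  qed
  have orbit: "b2 \<in> Y \<longleftrightarrow> b1 \<in> Y"
    if \<pi>: "\<pi> permutes {0..n}" and b1: "b1 \<in> B" and b2: "b2 \<in> B" and eq: "act \<pi> b1 = form_scale c b2"
    for \<pi> b1 b2 c
  proof -
    have step: "b2 \<in> Y" if \<pi>: "\<pi> permutes {0..n}" and b1: "b1 \<in> Y" and b2: "b2 \<in> B"
      and eq: "act \<pi> b1 = form_scale c b2" for \<pi> b1 b2 c
    proof -
      obtain \<sigma> d where \<sigma>: "\<sigma> permutes {0..n}" "act \<sigma> b = form_scale d b1"
        using b1 by (auto simp: Y_def)
      have "act (\<pi> \<circ> \<sigma>) b = form_scale (d * c) b2"
        using act_comp[OF \<pi> \<sigma>(1) B_in_V[OF assms(1)]] \<sigma>(2) eq by simp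
      then show ?thesis using b2 permutes_compose[OF \<sigma>(1) \<pi>] by (auto simp: Y_def)
    qed
    show ?thesis
      using step[OF \<pi> _ b2 eq] step[OF permutes_inv[OF \<pi>] _ b1 act_inv_scaled(2)[OF \<pi> b1 b2 eq]] by blast
  qed
  have Y_stable: "act \<pi> b1 \<in> cform.span Y" if \<pi>: "\<pi> permutes {0..n}" and "b1 \<in> Y" for \<pi> b1
  proof -
    have b1: "b1 \<in> B" using that(2) YB by blast
    obtain c b2 where b2: "b2 \<in> B" "act \<pi> b1 = form_scale c b2" using act_basis[OF \<pi> b1] by blast
    then have "b2 \<in> Y" using orbit[OF \<pi> b1 b2] that(2) by simp
    then show ?thesis using b2 by (simp add: cform.span_base cform.span_scale)
  qed
  have Z_stable: "act \<pi> b1 \<in> cform.span Z" if \<pi>: "\<pi> permutes {0..n}" and "b1 \<in> Z" for \<pi> b1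
  proof -
    have b1: "b1 \<in> B" using that(2) YB by blast
    obtain c b2 where b2: "b2 \<in> B" "act \<pi> b1 = form_scale c b2" using act_basis[OF \<pi> b1] by blast
    then have "b2 \<in> Z" using orbit[OF \<pi> b1 b2] that(2) by (simp add: Z_def)
    then show ?thesis using b2 by (simp add: cform.span_base cform.span_scale)
  qed
  have span_act: "act \<pi> u \<in> cform.span X"
    if \<pi>: "\<pi> permutes {0..n}" and u: "u \<in> cform.span X"
      and X: "\<And>b. b \<in> X \<Longrightarrow> act \<pi> b \<in> cform.span X" for \<pi> u X
    using u
  proof (induction rule: cform.span_induct_alt)
    case base
    then show ?case by (simp add: cform.span_zero)
  next
    case (step c x y)
    then show ?case using X by (simp add: cform.span_add cform.span_scale)
  qed
  define I where "I = {1..k}"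
  have I: "I \<in> index_sets k" using k by (auto simp: I_def index_sets_def)
  have "B = Y \<union> Z" using YB by (auto simp: Z_def)
  then have "basic_form I \<in> cform.span (Y \<union> Z)"
    using basic_form_in_constant_forms[OF I] span_B by simp
  then obtain y z where yz: "basic_form I = y + z" "y \<in> cform.span Y" "z \<in> cform.span Z"
    by (auto simp: cform.span_Un)
  have disj: "u = 0" if "u \<in> cform.span Y" "u \<in> cform.span Z" for u
  proof -
    have "cform.representation Y u = cform.representation B u"
      "cform.representation Z u = cform.representation B u"
      using cform.representation_extend[OF independent_B that(1) YB(1)]
        cform.representation_extend[OF independent_B that(2) YB(2)] by simp_all
    then have "cform.representation B u x = 0" for x
      using cform.representation_ne_zero[of Y u x] cform.representation_ne_zero[of Z u x]
      by (auto simp: Z_def)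
    moreover have "u \<in> cform.span B" using that(1) cform.span_mono[OF YB(1)] by blast
    ultimately show ?thesis
      using cform.sum_representation_eq[OF independent_B _ finite_B order.refl, of u] by simp
  qed
  have spanV: "cform.span Y \<subseteq> V" "cform.span Z \<subseteq> V"
    using cform.span_mono[OF YB(1)] cform.span_mono[OF YB(2)] span_B by auto
  \<comment> \<open>The spans of \<open>Y\<close> and \<open>Z\<close> are stable and meet only in
    0, so invariance of the sum y + z passes to each component.\<close>
  have inv: "act (transp 0 j) y = y" "act (transp 0 j) z = z" if j: "j \<in> {1..n}" "j \<notin> I" for j
  proof -
    have t: "transp 0 j permutes {0..n}" using j by (intro permutes_swap_id) auto
    have "act (transp 0 j) y + act (transp 0 j) z = y + z"
      using basic_form_act_invariant[OF I j] yz(1) by simp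
    then have eq: "act (transp 0 j) y - y = z - act (transp 0 j) z"
      by (simp add: algebra_simps)
    have "act (transp 0 j) y - y \<in> cform.span Y"
      using span_act[OF t yz(2) Y_stable[OF t]] yz(2) by (rule cform.span_diff)
    moreover have "act (transp 0 j) y - y \<in> cform.span Z"
      unfolding eq using yz(3) span_act[OF t yz(3) Z_stable[OF t]] by (rule cform.span_diff)
    ultimately have "act (transp 0 j) y - y = 0" by (rule disj)
    then show "act (transp 0 j) y = y" "act (transp 0 j) z = z" using eq by simp_all
  qed
  have y: "y = form_scale (coef I y) (basic_form I)"
    using invariants_of_transpositions[OF I _ inv(1)] spanV yz(2) by blast
  have z: "z = form_scale (coef I z) (basic_form I)"
    using invariants_of_transpositions[OF I _ inv(2)] spanV yz(3) by blast
  \<comment> \<open>A component with nonzero coefficient puts \<open>basic_form I\<close> into its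
    span, and then that part is all of \<open>B\<close>. For \<open>Z\<close> this is impossible
    because \<open>b\<close> lies in \<open>Y\<close>.\<close>
  have "coef I y + coef I z = 1"
    using coef_basic_form[OF I I] yz(1) by simp
  then consider "coef I y \<noteq> 0" | "coef I z \<noteq> 0" by fastforce
  then have "Y = B"
  proof cases
    case 1
    have "basic_form I = form_scale (inverse (coef I y)) y"
      using arg_cong[OF y, of "form_scale (inverse (coef I y))"] 1 by simp
    then have "basic_form I \<in> cform.span Y" using yz(2) by (simp add: cform.span_scale)
    then show ?thesis using stable_subset_eq[OF YB(1) Y_stable I] by blast
  next
    case 2
    have "basic_form I = form_scale (inverse (coef I z)) z"
      using arg_cong[OF z, of "form_scale (inverse (coef I z))"] 2 by simp
    then have "basic_form I \<in> cform.span Z" using yz(3) by (simp add: cform.span_scale)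
    then have "Z = B" using stable_subset_eq[OF YB(2) Z_stable I] by blast
    then show ?thesis using bY assms(1) by (auto simp: Z_def)
  qed
  then show ?thesis using assms(2) that by (auto simp: Y_def)
qed

text \<open>A nonzero trace has a nonzero diagonal entry, at some \<open>b1\<close>, so \<pi>
  stabilises the line of \<open>b1\<close>; transitivity provides an \<open>s\<close> carrying that
  line to the line of \<open>b\<close>.\<close>

lemma conjugate_in_stab:
  assumes \<pi>: "\<pi> permutes {0..n}" "tr k \<pi> \<noteq> 0" and b: "b \<in> B"
  obtains s where "s permutes {0..n}" "s \<circ> \<pi> \<circ> inv s \<in> stab b"
proof -
  have "(\<Sum>b\<in>B. chi b \<pi>) \<noteq> 0" using \<pi> tr_eq_sum_chi by simp
  then obtain b1 where b1: "b1 \<in> B" "chi b1 \<pi> \<noteq> 0" by (meson sum.neutral)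
  then have "\<pi> \<in> stab b1" using chi_outside[OF b1(1) \<pi>(1)] by blast
  then have eq: "act \<pi> b1 = form_scale (chi b1 \<pi>) b1" by (rule act_stab[OF b1(1)])
  obtain s c where s: "s permutes {0..n}" "act s b1 = form_scale c b"
    using act_transitive[OF b1(1) b] by blast
  note inv_s = act_inv_scaled[OF s(1) b1(1) b s(2)]
  have perm: "s \<circ> \<pi> \<circ> inv s permutes {0..n}" by (rule permutes_conj[OF \<pi>(1) s(1)])
  have "act (s \<circ> \<pi> \<circ> inv s) b = act (s \<circ> \<pi>) (act (inv s) b)"
    using act_comp[OF permutes_compose[OF \<pi>(1) s(1)] permutes_inv[OF s(1)] B_in_V[OF b]] by simp
  also have "\<dots> = form_scale (inverse c) (act s (act \<pi> b1))"
    unfolding inv_s(2) using act_comp[OF s(1) \<pi>(1) B_in_V[OF b1(1)]] by simp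
  also have "\<dots> = form_scale (inverse c * (chi b1 \<pi> * c)) b"
    by (simp add: eq s(2))
  finally have "s \<circ> \<pi> \<circ> inv s \<in> stab b" using perm by (auto simp: stab_def)
  with s(1) show ?thesis by (rule that)
qed

text \<open>Both act diagonally in \<open>B\<close>, so their commutator \<kappa> acts trivially on
  \<open>V\<close>. If \<kappa> moved some \<open>x\<close>, a k-set containing \<open>x\<close> but
  not \<open>\<kappa> x\<close>, which exists as 0 < k < n, would be moved, and its basic form with
  it.\<close>

lemma common_stabilizers_commute:
  assumes \<pi>: "\<pi> permutes {1..n}" "\<And>b. b \<in> B \<Longrightarrow> \<pi> \<in> stab b"
    and \<sigma>: "\<sigma> permutes {1..n}" "\<And>b. b \<in> B \<Longrightarrow> \<sigma> \<in> stab b"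
  shows "\<pi> \<circ> \<sigma> = \<sigma> \<circ> \<pi>"
proof (rule ext, rule ccontr)
  fix x assume ne: "(\<pi> \<circ> \<sigma>) x \<noteq> (\<sigma> \<circ> \<pi>) x"
  define \<kappa> where "\<kappa> = inv (\<sigma> \<circ> \<pi>) \<circ> (\<pi> \<circ> \<sigma>)"
  have sp: "\<sigma> \<circ> \<pi> permutes {1..n}" "\<pi> \<circ> \<sigma> permutes {1..n}"
    using \<pi>(1) \<sigma>(1) by (auto intro: permutes_compose)
  have \<kappa>: "\<kappa> permutes {1..n}" unfolding \<kappa>_def by (intro permutes_compose permutes_inv sp)
  have "(\<sigma> \<circ> \<pi>) (\<kappa> x) = (\<pi> \<circ> \<sigma>) x"
    using permutes_inverses(1)[OF sp(1)] by (simp add: \<kappa>_def)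
  then have \<kappa>x: "\<kappa> x \<noteq> x" using ne by metis
  then have x: "x \<in> {1..n}" "\<kappa> x \<in> {1..n}"
    using permutes_not_in[OF \<kappa>] permutes_in_image[OF \<kappa>] by blast+
  have "k - 1 \<le> card ({1..n} - {x, \<kappa> x})"
    using x \<kappa>x k by (simp add: card_Diff_subset)
  then obtain J' where J': "J' \<subseteq> {1..n} - {x, \<kappa> x}" "card J' = k - 1" "finite J'"
    by (metis obtain_subset_with_card_n)
  define J where "J = insert x J'"
  have "card J = k" unfolding J_def using J' k by (subst card_insert_disjoint) auto
  then have J: "J \<in> index_sets k" using J' x by (auto simp: J_def index_sets_def)
  have "act (\<pi> \<circ> \<sigma>) b = act (\<sigma> \<circ> \<pi>) b" if "b \<in> B" for b
    using chi_comp[OF that \<pi>(2)[OF that] \<sigma>(2)[OF that]] chi_comp[OF that \<sigma>(2)[OF that] \<pi>(2)[OF that]]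
    by (simp add: mult.commute)
  note on_B = this
  have "act (\<pi> \<circ> \<sigma>) u = act (\<sigma> \<circ> \<pi>) u" if "u \<in> cform.span B" for u
    using that
  proof (induction rule: cform.span_induct_alt)
    case (step c b y)
    then show ?case using on_B by (simp only: act_linear)
  qed simp
  then have "act (\<pi> \<circ> \<sigma>) (basic_form J) = act (\<sigma> \<circ> \<pi>) (basic_form J)"
    using basic_form_in_constant_forms[OF J] by (simp only: span_B)
  then have "act \<kappa> (basic_form J) = basic_form J"
    unfolding \<kappa>_def
    using act_comp[OF permutes_inv[OF permutes_with_0[OF sp(1)]] permutes_with_0[OF sp(2)]
        basic_form_in_constant_forms[OF J]]
      act_inv_act(1)[OF permutes_with_0[OF sp(1)] basic_form_in_constant_forms[OF J]] by simp
  moreover have "\<kappa> ` J \<noteq> J" using J' \<kappa>x by (auto simp: J_def)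
  ultimately show False
    using coef_act_other[OF \<kappa> J J] coef_basic_form[OF J J] by simp
qed

section \<open>Blocks and small cycles in the stabiliser of a line\<close>

lemma stab_dichotomy:
  assumes b: "b \<in> B" and r: "perm_group.invariant_equiv {0..n} (stab b) r"
    and "x0 \<in> {0..n}" "y0 \<in> {0..n}" "x0 \<noteq> y0" "r x0 y0"
  obtains "\<And>x y. x \<in> {0..n} \<Longrightarrow> y \<in> {0..n} \<Longrightarrow> r x y"
  | m where "n + 1 = 2 * m" "k = m \<or> k + 1 = m" "\<And>x. x \<in> {0..n} \<Longrightarrow> card {y \<in> {0..n}. r x y} = m"
proof -
  interpret perm_group_nat n "stab b" by (rule perm_group_stab[OF b])
  obtain s0 where s0: "s0 permutes {0..n}" "s0 \<circ> cyc 0 n \<circ> inv s0 \<in> stab b"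
    using conjugate_in_stab[OF cyc_permutes[OF le0] tr_long_cycle_nonzero[OF k] b] by blast
  obtain s1 where s1: "s1 permutes {0..n}" "s1 \<circ> (cyc 1 k \<circ> cyc (Suc k) n) \<circ> inv s1 \<in> stab b"
    using conjugate_in_stab[OF permutes_with_0[OF two_cycles_permutes[OF k]] tr_two_cycles_nonzero[OF k] b]
    by blast
  have s2: "\<exists>s. s permutes {0..n} \<and> s \<circ> cyc 1 a \<circ> inv s \<in> stab b"
    if a: "min k (n - k) < a" "a \<le> max k (n - k)" for a
  proof -
    have "cyc 1 a permutes {0..n}" using a k by (intro cyc_permutes_superset) auto
    then show ?thesis using conjugate_in_stab[OF _ tr_cyc_nonzero[OF k a] b] by blast
  qed
  show ?thesis
    using block_dichotomy[OF r assms(3-6) k s0 s1 s2] that by blast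
qed

lemma stab_transitive:
  assumes b: "b \<in> B" and xy: "x \<in> {0..n}" "y \<in> {0..n}"
  obtains p where "p \<in> stab b" "p x = y"
proof -
  interpret perm_group_nat n "stab b" by (rule perm_group_stab[OF b])
  obtain s where "s permutes {0..n}" "s \<circ> cyc 0 n \<circ> inv s \<in> stab b"
    using conjugate_in_stab[OF cyc_permutes[OF le0] tr_long_cycle_nonzero[OF k] b] by blast
  then show ?thesis using transitive[OF _ _ xy] that by blast
qed

lemma chi_mult:
  "b \<in> B \<Longrightarrow> \<pi> \<in> stab b \<Longrightarrow> \<sigma> \<in> stab b \<Longrightarrow> chi b (\<pi> \<circ> \<sigma>) = chi b \<pi> * chi b \<sigma>"
  using chi_eq chi_comp by blast

lemma chi_id: "b \<in> B \<Longrightarrow> chi b id = 1"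
  using act_id[OF B_in_V, of b] by (intro chi_eq) simp_all

lemma chi_conj:
  assumes "b \<in> B" "\<pi> \<in> stab b" "\<sigma> \<in> stab b"
  shows "chi b (\<pi> \<circ> \<sigma> \<circ> inv \<pi>) = chi b \<sigma>"
proof -
  interpret perm_group_nat n "stab b" by (rule perm_group_stab[OF assms(1)])
  have "chi b \<pi> * chi b (inv \<pi>) = 1"
    using chi_mult[OF assms(1,2) inv_in[OF assms(2)]] chi_id[OF assms(1)]
      permutes_inv_o(1)[OF stab_permutes[OF assms(2)]] by simp
  then show ?thesis
    using assms by (simp add: chi_mult comp_in inv_in mult.commute mult.left_commute)
qed

text \<open>For n = 2 k the two binomial coefficients in the trace of a transposition agree by
  symmetry and the trace vanishes; the hypothesis excludes this.\<close>

lemma transposition_in_stab: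
  assumes b: "b \<in> B" and "n \<noteq> 2 * k" "4 \<le> n"
  obtains x y where "x \<in> {0..n}" "y \<in> {0..n}" "x \<noteq> y" "transp x y \<in> stab b"
proof -
  have c: "cyc 1 2 permutes {0..n}" using assms by (intro cyc_permutes_superset) auto
  have n2: "2 \<le> n" using assms(3) by simp
  have "tr k (cyc 1 2) \<noteq> 0"
    unfolding tr_transposition[OF n2] right_minus_eq of_nat_eq_iff
    by (rule binomial_shift2_ne[OF k assms(2,3)])
  then obtain s where s: "s permutes {0..n}" "s \<circ> cyc 1 2 \<circ> inv s \<in> stab b"
    using conjugate_in_stab[OF c _ b] by blast
  then have "transp (s 1) (s 2) \<in> stab b"
    using conj_transpose[OF permutes_bij[OF s(1)]] by (simp only: cyc_1_2)
  moreover have "s 1 \<in> {0..n}" "s 2 \<in> {0..n}"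
    using permutes_in_image[OF s(1)] assms by simp_all
  moreover have "s 1 \<noteq> s 2" using permutes_inj[OF s(1)] by (metis injD numeral_eq_one_iff semiring_norm(85))
  ultimately show ?thesis using that by blast
qed

text \<open>In the imprimitive case the two transpositions each preserve a block, so they lie in the
  stabiliser; being conjugate there, they have the same sign.\<close>

lemma chi_double_transposition:
  assumes b: "b \<in> B" and n: "n \<noteq> 2 * k" "5 \<le> n"
    and d: "transp 1 2 \<circ> transp 3 4 \<in> stab b"
  shows "chi b (transp 1 2 \<circ> transp 3 4) = 1"
proof -
  interpret perm_group_nat n "stab b" by (rule perm_group_stab[OF b])
  let ?r = "\<lambda>x y. x = y \<or> transp x y \<in> stab b"
  let ?d = "transp 1 2 \<circ> transp (3::nat) 4"
  note r = invariant_equiv_transpose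
  note req = invariant_equivD[OF r]
  have n4: "4 \<le> n" using n by simp
  obtain x0 y0 where xy0: "x0 \<in> {0..n}" "y0 \<in> {0..n}" "x0 \<noteq> y0" "transp x0 y0 \<in> stab b"
    by (rule transposition_in_stab[OF b n(1) n4])
  \<comment> \<open>The double transposition fixes 0, hence preserves the class of 0 and, as there
    are at most two classes, also the complementary one. So a point and its image are always in the
    same class.\<close>
  have rel: "?r x y"
    if xy: "x \<in> {1..4}" "y \<in> {1..4}" "?d x = y" "?d y = x" for x y
  proof -
    have S: "x \<in> {0..n}" "y \<in> {0..n}" "0 \<in> {0..n}" using xy n by auto
    have d0: "?d 0 = 0" by simp
    show ?thesis
    proof (rule stab_dichotomy[OF b r xy0(1,2,3) disjI2[OF xy0(4)]])
      assume "\<And>x y. x \<in> {0..n} \<Longrightarrow> y \<in> {0..n} \<Longrightarrow> ?r x y"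
      then show ?thesis using S by blast
    next
      fix m assume m: "n + 1 = 2 * m" "\<And>x. x \<in> {0..n} \<Longrightarrow> card {y \<in> {0..n}. ?r x y} = m"
      have swap: "?r 0 x \<longleftrightarrow> ?r 0 y"
        using req(4)[OF d S(3) S(1)] req(4)[OF d S(3) S(2)] d0 xy(3,4) by metis
      show ?thesis
      proof (cases "?r 0 x")
        case True
        then show ?thesis using swap req(3)[OF S(1) S(3) S(2) req(2)[OF S(3) S(1)]] by blast
      next
        case False
        let ?C = "\<lambda>x. {y \<in> {0..n}. ?r x y}"
        have "?C x \<inter> ?C 0 = {}"
        proof (rule ccontr)
          assume "?C x \<inter> ?C 0 \<noteq> {}"
          then obtain z where z: "z \<in> {0..n}" "?r x z" "?r 0 z" by blast
          then show False using False req(3)[OF S(3) z(1) S(1) z(3) req(2)[OF S(1) z(1,2)]] by blast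
        qed
        then have "card (?C x \<union> ?C 0) = card {0..n}"
          using m(1) m(2)[OF S(1)] m(2)[OF S(3)] by (subst card_Un_disjoint) simp_all
        then have "?C x \<union> ?C 0 = {0..n}" by (intro card_subset_eq) auto
        then have "y \<in> ?C x" using S(2) swap False by blast
        then show ?thesis by blast
      qed
    qed
  qed
  have t: "transp 1 2 \<in> stab b" using rel[of 1 2] by simp
  have t': "transp 3 4 \<in> stab b" using rel[of 3 4] by simp
  have S: "1 \<in> {0..n}" "2 \<in> {0..n}" "3 \<in> {0..n}" "4 \<in> {0..n}" using n by auto
  obtain h where h: "h \<in> stab b" "h 1 = 3" by (rule stab_transitive[OF b S(1,3)])
  \<comment> \<open>Invariance puts \<open>h 2\<close> into the class of 3, which also contains 4.
    So the transposition of \<open>h 2\<close> and 4 lies in the stabiliser, and it corrects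
    \<open>h\<close> without moving 3.\<close>
  obtain h' where h': "h' \<in> stab b" "h' 1 = 3" "h' 2 = 4"
  proof (cases "h 2 = 4")
    case True
    then show ?thesis using h that by blast
  next
    case False
    let ?z = "h 2"
    have zS: "?z \<in> {0..n}" using in_S[OF h(1)] S(2) by simp
    have z3: "?z \<noteq> 3" using h(2) bij_in[OF h(1)] by (metis bij_pointE numeral_eq_one_iff semiring_norm(85))
    have "?r 3 ?z" using req(4)[OF h(1) S(1,2) disjI2[OF t]] h(2) by simp
    then have "?r ?z 4"
      using req(3)[OF zS S(3,4) req(2)[OF S(3) zS] disjI2[OF t']] by blast
    then have z4: "transp ?z 4 \<in> stab b" using False by blast
    show ?thesis
    proof (rule that[of "transp ?z 4 \<circ> h"])
      show "transp ?z 4 \<circ> h \<in> stab b" by (rule comp_in[OF z4 h(1)])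
      show "(transp ?z 4 \<circ> h) 1 = 3" using h(2) z3 by (simp add: Transposition.transpose_def)
    qed simp
  qed
  have "h' \<circ> transp 1 2 \<circ> inv h' = transp 3 4"
    using conj_transpose[OF bij_in[OF h'(1)]] h'(2,3) by simp
  then have "chi b (transp 3 4) = chi b (transp 1 2)"
    using chi_conj[OF b h'(1) t] by simp
  \<comment> \<open>With equal values at both transpositions the product is a square, and it is 1
    since a transposition is an involution.\<close>
  moreover have "chi b (transp 1 2) * chi b (transp 1 2) = 1"
    using chi_mult[OF b t t] chi_id[OF b] by simp
  ultimately show ?thesis using chi_mult[OF b t t'] by simp
qed

lemma transpositions_not_common:
  assumes "4 \<le> n" "\<And>b x y. b \<in> B \<Longrightarrow> x \<in> {0..n} \<Longrightarrow> y \<in> {0..n} \<Longrightarrow> x = y \<or> transp x y \<in> stab b"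
  shows False
proof -
  have "transp 1 2 \<circ> transp 2 3 = transp 2 3 \<circ> transp 1 (2::nat)"
  proof (rule common_stabilizers_commute)
    show "transp 1 2 permutes {1..n}" "transp 2 3 permutes {1..n}"
      using assms(1) by (auto intro!: permutes_swap_id)
    show "transp 1 2 \<in> stab b" "transp 2 3 \<in> stab b" if "b \<in> B" for b
      using assms(2)[OF that, of 1 2] assms(2)[OF that, of 2 3] assms(1) by auto
  qed
  from fun_cong[OF this, of 3] show False by (simp add: Transposition.transpose_def)
qed

lemma three_cycles_not_common:
  assumes "4 \<le> n" "\<And>b x y z. b \<in> B \<Longrightarrow> x \<in> {0..n} \<Longrightarrow> y \<in> {0..n} \<Longrightarrow> z \<in> {0..n} \<Longrightarrow>
    x \<noteq> y \<Longrightarrow> y \<noteq> z \<Longrightarrow> x \<noteq> z \<Longrightarrow> cyc3 x y z \<in> stab b"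
  shows False
proof -
  have "cyc3 1 2 3 \<circ> cyc3 1 2 4 = cyc3 1 2 4 \<circ> cyc3 1 2 (3::nat)"
  proof (rule common_stabilizers_commute)
    show "cyc3 1 2 3 permutes {1..n}" "cyc3 1 2 4 permutes {1..n}"
      unfolding cyc3_def using assms(1) by (auto intro!: permutes_compose permutes_swap_id)
    show "cyc3 1 2 3 \<in> stab b" "cyc3 1 2 4 \<in> stab b" if "b \<in> B" for b
      using assms(2)[OF that, of 1 2 3] assms(2)[OF that, of 1 2 4] assms(1) by auto
  qed
  from fun_cong[OF this, of 1] show False by (simp add: cyc3_def Transposition.transpose_def)
qed

lemma exceptional_dimension:
  assumes n: "4 \<le> n"
  shows "k = 2 \<and> n = 4"
proof (rule ccontr)
  assume not24: "\<not> (k = 2 \<and> n = 4)"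
  show False
  proof (cases "n = 2 * k")
    case True
    then have k3: "3 \<le> k" using n not24 by simp
    show False
    proof (rule three_cycles_not_common[OF n])
      fix b x y z assume b: "b \<in> B" and xyz: "x \<in> {0..n}" "y \<in> {0..n}" "z \<in> {0..n}"
        "x \<noteq> y" "y \<noteq> z" "x \<noteq> z"
      interpret perm_group_nat n "stab b" by (rule perm_group_stab[OF b])
      have c: "cyc 1 3 permutes {0..n}" using n by (intro cyc_permutes_superset) auto
      obtain s where s: "s permutes {0..n}" "s \<circ> cyc 1 3 \<circ> inv s \<in> stab b"
        using conjugate_in_stab[OF c tr_cyc3_nonzero[OF True k3] b] by blast
      have s_in: "s 1 \<in> {0..n}" "s 2 \<in> {0..n}"
        using permutes_in_image[OF s(1)] n by simp_all
      have s_eq: "s i = s j \<longleftrightarrow> i = j" for i j using permutes_inj[OF s(1)] by (auto dest: injD)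
      have "three (s 1) (s 2) (s 3)"
        using s(2) conj_cyc3[OF permutes_bij[OF s(1)], of 1 2 3]
        unfolding three_def cyc_1_3 s_eq by simp
      then have ex: "\<exists>t. three (s 1) (s 2) t" by blast
      have all: "x = y \<or> (\<exists>t. three x y t)" if "x \<in> {0..n}" "y \<in> {0..n}" for x y
      proof (rule stab_dichotomy[OF b invariant_equiv_three s_in _ disjI2[OF ex]])
        show "s 1 \<noteq> s 2" unfolding s_eq by simp
      next
        \<comment> \<open>Two blocks of equal size cannot occur because n + 1 is odd.\<close>
        fix m assume "n + 1 = 2 * m"
        then show ?thesis using True by presburger
      qed (use that in blast)
      then show "cyc3 x y z \<in> stab b"
        using three_all[OF _ xyz] unfolding three_def by blast
    qed
  next
    case False
    show False
    proof (cases "\<exists>m. n + 1 = 2 * m \<and> (k = m \<or> k + 1 = m)")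
      case noblocks: False
      show False
      proof (rule transpositions_not_common[OF n])
        fix b x y assume b: "b \<in> B" and xy: "x \<in> {0..n}" "y \<in> {0..n}"
        interpret perm_group_nat n "stab b" by (rule perm_group_stab[OF b])
        obtain x0 y0 where xy0: "x0 \<in> {0..n}" "y0 \<in> {0..n}" "x0 \<noteq> y0" "transp x0 y0 \<in> stab b"
          by (rule transposition_in_stab[OF b False n])
        show "x = y \<or> transp x y \<in> stab b"
          by (rule stab_dichotomy[OF b invariant_equiv_transpose xy0(1-3) disjI2[OF xy0(4)]])
             (use xy noblocks in blast)+
      qed
    next
      case True
      then obtain m where m: "n + 1 = 2 * m" "k = m \<or> k + 1 = m" by blast
      then have m3: "3 \<le> m" and n5: "5 \<le> n" and k2: "2 \<le> k" using n by presburger+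
      let ?d = "transp 1 2 \<circ> transp (3::nat) 4"
      have d: "?d permutes {0..n}"
        using n by (intro permutes_compose permutes_swap_id) auto
      \<comment> \<open>\<open>p\<close> counts the sets contributing 1 to the trace,
        \<open>q\<close> those contributing -1.\<close>
      define p q where "p = ((n - 4) choose k) + (if 4 \<le> k then (n - 4) choose (k - 4) else 0)"
        and "q = 2 * ((n - 4) choose (k - 2))"
      have "p < q" unfolding p_def q_def by (rule binomial_shift4_less[OF m(1) m3 m(2)])
      have "tr k ?d = of_nat p - of_nat q"
        using tr_double_transposition[OF n k2] by (simp add: cyc_1_2[unfolded One_nat_def] cyc_3_4 p_def q_def)
      then have "Re (tr k ?d) < 0" using \<open>p < q\<close> by simp
      \<comment> \<open>Each diagonal entry is 1 on the stabiliser and 0 off it, so the trace cannot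
        be negative.\<close>
      moreover have "0 \<le> Re (chi b ?d)" if b: "b \<in> B" for b
        using chi_double_transposition[OF b False n5] chi_outside[OF b d] by (cases "?d \<in> stab b") simp_all
      then have "0 \<le> Re (\<Sum>b\<in>B. chi b ?d)"
        unfolding Re_sum by (rule sum_nonneg)
      ultimately show False using tr_eq_sum_chi[OF d] by simp
    qed
  qed
qed

end

theorem theorem5p8:
  fixes v :: "nat \<Rightarrow> 'a::euclidean_space" and n k :: nat
  assumes "simplex_vertices n v"
    and "k \<le> n"
    and "\<exists>B. form_basis B (constant_forms n v k) \<and> C_invariant n v B"
  shows "k = 0 \<or> k = n \<or> n \<le> 3 \<or> (k = 2 \<and> n = 4)"
proof (rule ccontr)
  assume contra: "\<not> (k = 0 \<or> k = n \<or> n \<le> 3 \<or> (k = 2 \<and> n = 4))"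
  obtain B where "form_basis B (constant_forms n v k)" "C_invariant n v B"
    using assms(3) by blast
  then interpret monomial_basis n v k B
    using assms(1,2) contra by unfold_locales auto
  show False using exceptional_dimension contra by simp
qed

end
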